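(* For odd, square-free $n>3$, with $s=(-1)^{(n-1)/2}$, the polynomials $A_n(x)$ and $B_n(x)$ occurring in Gauss's identity $4\Phi_n(x)=A_n(x)^2-(-1)^{(n-1)/2}\,n\,B_n(x)^2$ are $$A_n(x)=2\sqrt{\Phi_n(x)}\,\cosh\left(\frac{\sqrt{sn}}{2}f_n(x)\right)$$ and $$B_n(x)=2\sqrt{\frac{\Phi_n(x)}{sn}}\,\sinh\left(\frac{\sqrt{sn}}{2}f_n(x)\right).$$
   Context: $\Phi_n$ denotes the $n$-th cyclotomic polynomial. For odd square-free $n>1$, $A_n(x)$ and $B_n(x)$ are the polynomials with integer coefficients, normalized so that $A_n(x)/2$ and $B_n(x)$ are monic, satisfying Gauss's identity $4\Phi_n(x)=A_n(x)^2-(-1)^{(n-1)/2}\,n\,B_n(x)^2$. $(j\,|\,n)$ denotes the Jacobi symbol, taken to be $0$ if $\gcd(j,n)>1$. For $|x|\le 1$, $$f_n(x)=\sum_{j=1}^\infty (j\,|\,n)\,\frac{x^j}{j},$$ and $f_n$ is continued analytically outside the unit circle by $f_n(x)=f_n(1/x)$ if $n\equiv 1 \pmod 4$, and $f_n(x)+f_n(1/x)=2f_n(1)$ if $n\equiv 3\pmod 4$. If $m<0$ then $\sqrt{m}$ means $i\sqrt{|m|}$; in particular $\sqrt{sn}=i\sqrt n$ when $s=-1$. When $s=-1$ the formulas are read as $A_n(x)=2\sqrt{\Phi_n(x)}\cos\left(\frac{\sqrt n}{2}f_n(x)\right)$ and $B_n(x)=2\sqrt{\Phi_n(x)/n}\,\sin\left(\frac{\sqrt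 n}{2}f_n(x)\right)$. The formulas may be interpreted as generating functions, with $\sqrt{\Phi_n(x)}$ and $f_n(x)$ taken as power series in $x$ and the positive sign of the square root, or as exact expressions, in which case the square root is positive for real $x$ and the same branch is taken throughout any simply connected closed region containing no zero of $\Phi_n$.
   Formalization: For n≡3 mod 4 the formulas fail by sign for the monic pair (n=7: A(0)=-2, formula +2), so explicit signs ±1 are inserted (+1 if n≡1 mod 4); the exact form is stated on regions where f_n is continuous and the root is positive at a real point, as the reflected f_n jumps across some arcs. *)

theory Defs
  imports
    "HOL-Analysis.Analysis"
    "HOL-Computational_Algebra.Computational_Algebra"
    "HOL-Number_Theory.Number_Theory"
begin

definition cyclotomic :: "nat \<Rightarrow> complex poly" where
  "cyclotomic n = (\<Prod>k | k \<in> {1..n} \<and> coprime k n. [:- cis (2 * pi * real k / real n), 1:])"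

text \<open>\<^const>\<open>Legendre\<close> takes the value 0 on multiples of the prime, so the product below
  is 0 whenever the arguments have a common factor.\<close>

definition jacobi :: "int \<Rightarrow> nat \<Rightarrow> int" where
  "jacobi a n = (\<Prod>p\<in>#prime_factorization n. Legendre a (int p))"

definition gauss_s :: "nat \<Rightarrow> int" where
  "gauss_s n = (-1) ^ ((n - 1) div 2)"

text \<open>The principal square root is the convention wanted here:
  \<open>csqrt (- m) = \<i> * sqrt m\<close> for real \<open>m > 0\<close>.\<close>

definition sqrt_sn :: "nat \<Rightarrow> complex" where
  "sqrt_sn n = csqrt (of_int (gauss_s n * int n))"

definition gauss_pair :: "nat \<Rightarrow> int poly \<Rightarrow> int poly \<Rightarrow> bool" where
  "gauss_pair n A B \<longleftrightarrow>
     Polynomial.smult 4 (cyclotomic n) =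
       (map_poly of_int A)\<^sup>2 - Polynomial.smult (of_int (gauss_s n * int n)) ((map_poly of_int B)\<^sup>2) \<and>
     lead_coeff A = 2 \<and> lead_coeff B = 1"

definition f_series :: "nat \<Rightarrow> complex \<Rightarrow> complex" where
  "f_series n x = (\<Sum>j. of_int (jacobi (int (Suc j)) n) * x ^ Suc j / of_nat (Suc j))"

definition f_fun :: "nat \<Rightarrow> complex \<Rightarrow> complex" where
  "f_fun n x =
     (if norm x \<le> 1 then f_series n x
      else if n mod 4 = 1 then f_series n (1 / x)
      else 2 * f_series n 1 - f_series n (1 / x))"

definition f_fps :: "nat \<Rightarrow> complex fps" where
  "f_fps n = Abs_fps (\<lambda>j. if j = 0 then 0 else of_int (jacobi (int j) n) / of_nat j)"

text \<open>The square root of the cyclotomic polynomial as a power series, with constant term 1.\<close>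

definition cyclotomic_sqrt_fps :: "nat \<Rightarrow> complex fps" where
  "cyclotomic_sqrt_fps n = fps_radical (\<lambda>_. csqrt) 2 (fps_of_poly (cyclotomic n))"

definition fps_cosh :: "complex \<Rightarrow> complex fps" where
  "fps_cosh c = fps_const (1 / 2) * (fps_exp c + fps_exp (- c))"

definition fps_sinh :: "complex \<Rightarrow> complex fps" where
  "fps_sinh c = fps_const (1 / 2) * (fps_exp c - fps_exp (- c))"

text \<open>
  For \<open>n mod 4 = 3\<close> the polynomials given by the closed formulas are only equal up to sign to
  those for which \<open>A / 2\<close> and \<open>B\<close> are monic.  With the square root of the cyclotomic polynomial
  positive at 0, the formulas have the lowest terms \<open>2\<close> and \<open>x\<close>, whereas the monic pair is
  \<open>2x^3 + x^2 - x - 2\<close>, \<open>x^2 + x\<close> for \<open>n = 7\<close> and \<open>2x^4 - x^3 - 4x^2 - x + 2\<close>, \<open>x^3 - x\<close> for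
  \<open>n = 15\<close>.  In general exactly one of the two formulas has the wrong sign, the first if \<open>n\<close> is
  prime and the second if \<open>n\<close> is composite.

  The argument \<open>t\<close> is the real point at which the square root is taken to be positive.  If \<open>n\<close> is
  a prime with \<open>n mod 4 = 3\<close>, then half the degree of the cyclotomic polynomial is odd, and the
  square root that is positive for real \<open>t < -1\<close> differs by a factor \<open>-1\<close> from the one that is
  positive for \<open>t > 1\<close> and is continued through \<open>norm x > 1\<close>; both signs then change.
\<close>

definition sign_A :: "nat \<Rightarrow> real \<Rightarrow> complex" where
  "sign_A n t = (if n mod 4 = 3 \<and> prime n \<and> - 1 \<le> t then - 1 else 1)"

definition sign_B :: "nat \<Rightarrow> real \<Rightarrow> complex" where
  "sign_B n t = (if n mod 4 = 3 \<and> \<not> (prime n \<and> - 1 \<le> t) then - 1 else 1)"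

text \<open>
  A branch \<open>g\<close> of the square root of the cyclotomic polynomial on a closed simply connected set
  \<open>R\<close> without zeros of that polynomial, positive at the real point \<open>t\<close> of \<open>R\<close>.  Continuity of
  \<^const>\<open>f_fun\<close> on \<open>R\<close> says that the reflection formula is the continuation of the series
  wherever \<open>R\<close> crosses the unit circle; this is so at the arc between zeros that contains 1, but
  not at every arc.
\<close>

definition sqrt_branch :: "nat \<Rightarrow> complex set \<Rightarrow> real \<Rightarrow> (complex \<Rightarrow> complex) \<Rightarrow> bool" where
  "sqrt_branch n R t g \<longleftrightarrow>
     closed R \<and> simply_connected R \<and> (\<forall>x\<in>R. poly (cyclotomic n) x \<noteq> 0) \<and>
     continuous_on R (f_fun n) \<and>
     continuous_on R g \<and> (\<forall>x\<in>R. (g x)\<^sup>2 = poly (cyclotomic n) x) \<and>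
     of_real t \<in> R \<and> g (of_real t) = of_real (sqrt (Re (poly (cyclotomic n) (of_real t))))"

end

theory Submission
  imports Defs "HOL-Complex_Analysis.Laurent_Convergence"
begin

text \<open>
  Let \<open>\<zeta> = exp (2 \<pi> i / n)\<close>, let \<open>\<chi>\<close> be the Jacobi symbol modulo \<open>n\<close> and \<open>\<tau>\<close> its Gauss sum, so
  that \<open>\<tau>\<^sup>2 = s n\<close>.  Split the cyclotomic polynomial as \<open>F\<^sub>+ F\<^sub>-\<close> according to the value
  of \<open>\<chi>\<close> at the exponents of the roots.  Irreducibility of the cyclotomic polynomial forces the
  factors \<open>A \<plusminus> \<tau> B\<close> of its fourfold to be \<open>2 F\<^sub>+\<close> and \<open>2 F\<^sub>-\<close>, and comparing second
  coefficients fixes which is which: \<open>A = F\<^sub>+ + F\<^sub>-\<close> and \<open>\<tau> B = F\<^sub>- - F\<^sub>+\<close>.  On the other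
  hand \<open>\<chi>(j) \<tau> = \<Sum>\<^sub>k \<chi>(k) \<zeta>\<^sup>j\<^sup>k\<close> gives \<open>\<tau> f(x) = - \<Sum>\<^sub>k \<chi>(k) log (1 - \<zeta>\<^sup>k x)\<close>, so that
  \<open>exp (\<tau> f) = R\<^sub>- / R\<^sub>+\<close> for the reciprocal products \<open>R\<^sub>\<plusminus>\<close>, which agree with \<open>F\<^sub>\<plusminus>\<close> up to
  sign and order.  Multiplying \<open>exp (\<plusminus> \<tau> f / 2)\<close> by the square root of \<open>R\<^sub>+ R\<^sub>-\<close> gives
  \<open>R\<^sub>\<minusplus>\<close> up to a sign that is constant on connected sets.  All formulas are even in \<open>\<tau>\<close>, so
  the sign of the Gauss sum is irrelevant.
\<close>

section \<open>The Jacobi symbol\<close>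

lemma Legendre_cong:
  assumes "[a = b] (mod p)"
  shows "Legendre a p = Legendre b p"
proof -
  have "[a = 0] (mod p) \<longleftrightarrow> [b = 0] (mod p)"
    using assms cong_sym cong_trans by blast
  moreover have "QuadRes p a \<longleftrightarrow> QuadRes p b"
    unfolding QuadRes_def using assms cong_sym cong_trans by blast
  ultimately show ?thesis by (simp add: Legendre_def)
qed

lemma Legendre_values: "Legendre a p \<in> {-1, 0, 1}"
  by (simp add: Legendre_def)

text \<open>Euler's criterion determines Legendre symbols only modulo p. For p > 2 the numbers -1, 0
  and 1 are pairwise incongruent, so such congruences become equations.\<close>

lemma eq_if_cong_small:
  fixes u v p :: int
  assumes "[u = v] (mod p)" "\<bar>u\<bar> \<le> 1" "\<bar>v\<bar> \<le> 1" "2 < p"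
  shows "u = v"
proof -
  have "p dvd u - v" using assms(1) by (simp add: cong_iff_dvd_diff)
  moreover have "\<bar>u - v\<bar> < p" using assms by linarith
  ultimately show ?thesis using zdvd_not_zless zdvd_imp_le
    by (metis abs_of_pos dvd_abs_iff eq_iff_diff_eq_0 linorder_not_less zero_less_abs_iff)
qed

lemma Legendre_mult:
  assumes "prime p" "2 < (p::nat)"
  shows "Legendre (a * b) p = Legendre a p * Legendre b p"
proof (rule eq_if_cong_small)
  let ?e = "(p - 1) div 2"
  have "[Legendre (a * b) p = (a * b) ^ ?e] (mod p)"
    using euler_criterion[OF assms] .
  also have "(a * b) ^ ?e = a ^ ?e * b ^ ?e" by (rule power_mult_distrib)
  also have "[\<dots> = Legendre a p * Legendre b p] (mod p)"
    by (intro cong_mult cong_sym[OF euler_criterion[OF assms]])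
  finally show "[Legendre (a * b) p = Legendre a p * Legendre b p] (mod p)" .
qed (use assms Legendre_values[of a p] Legendre_values[of b p] Legendre_values[of "a*b" p] in auto)

lemma Legendre_minus_one:
  assumes "prime p" "2 < (p::nat)"
  shows "Legendre (- 1) p = (- 1) ^ ((p - 1) div 2)"
proof (rule eq_if_cong_small)
  show "[Legendre (- 1) p = (- 1) ^ ((p - 1) div 2)] (mod p)"
    using euler_criterion[OF assms] .
qed (use assms Legendre_values[of "-1" p] in auto)

text \<open>The witness is a primitive root: if it were a residue, Euler's criterion would make its
  order \<open>p - 1\<close> divide \<open>(p - 1) div 2\<close>.\<close>

lemma Legendre_nonresidue_exists:
  assumes "prime p" "2 < (p::nat)"
  shows "\<exists>a. coprime a p \<and> Legendre (int a) p = - 1"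
proof -
  obtain g where g: "residue_primroot p g"
    using residue_primroot_odd_prime_power_exists[of p] assms
    by (metis One_nat_def linorder_not_less not_less_iff_gr_or_eq prime_odd_nat power_one_right zero_less_one)
  then have cop: "coprime g p" and ord: "ord p g = p - 1"
    using assms by (auto simp: residue_primroot_def totient_prime coprime_commute)
  have "Legendre (int g) p \<noteq> 1"
  proof
    assume "Legendre (int g) p = 1"
    then have "[1 = int g ^ ((p - 1) div 2)] (mod p)"
      using euler_criterion[OF assms, of "int g"] by simp
    then have "[g ^ ((p - 1) div 2) = 1] (mod p)"
      using cong_int_iff cong_sym by (metis of_nat_1 of_nat_power)
    then have "p - 1 dvd (p - 1) div 2"
      using ord ord_divides by metis
    moreover have "0 < (p - 1) div 2" "(p - 1) div 2 < p - 1"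
      using assms by auto
    ultimately show False using nat_dvd_not_less by blast
  qed
  moreover have "Legendre (int g) p \<noteq> 0"
  proof
    assume "Legendre (int g) p = 0"
    then have "int p dvd int g"
      by (auto simp: Legendre_def cong_0_iff split: if_splits)
    then have "p dvd g" by simp
    then show False using cop assms by (metis coprime_absorb_right coprime_commute not_prime_unit)
  qed
  ultimately show ?thesis using cop Legendre_values[of "int g" p] by auto
qed

section \<open>The Jacobi symbol for an odd square-free modulus\<close>

locale odd_squarefree =
  fixes n :: nat
  assumes n_odd: "odd n" and n_squarefree: "squarefree n" and n_gt: "n > 3"
begin

lemma prime_factor_gt_2: "p \<in> prime_factors n \<Longrightarrow> 2 < p"
  using n_odd prime_ge_2_nat[of p] in_prime_factors_iff[of p n]
  by (cases "p = 2") auto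

lemma prime_factorization_mset_set: "prime_factorization n = mset_set (prime_factors n)"
proof (rule multiset_eqI)
  fix p
  show "count (prime_factorization n) p = count (mset_set (prime_factors n)) p"
  proof (cases "p \<in> prime_factors n")
    case True
    then have "multiplicity p n = 1"
      using n_squarefree n_gt squarefree_factorial_semiring'[of n] by simp
    then show ?thesis using True by (simp add: count_prime_factorization in_prime_factors_iff)
  qed (auto simp: not_in_iff)
qed

lemma jacobi_prod: "jacobi a n = (\<Prod>p\<in>prime_factors n. Legendre a (int p))"
  unfolding jacobi_def prod_unfold_prod_mset
  using arg_cong[OF prime_factorization_mset_set, of "\<lambda>M. \<Prod>p\<in>#M. Legendre a (int p)"] by simp

lemma n_prod: "(\<Prod>p\<in>prime_factors n. p) = n"
proof -
  have "prod_mset (prime_factorization n) = n"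
    using prod_mset_prime_factorization_nat n_gt by simp
  then show ?thesis
    using arg_cong[OF prime_factorization_mset_set, of prod_mset]
    by (simp add: prod_unfold_prod_mset)
qed

lemma jacobi_mult: "jacobi (a * b) n = jacobi a n * jacobi b n"
  unfolding jacobi_prod prod.distrib[symmetric]
proof (rule prod.cong[OF refl])
  fix p assume "p \<in> prime_factors n"
  then show "Legendre (a * b) (int p) = Legendre a (int p) * Legendre b (int p)"
    using Legendre_mult[of p a b] prime_factor_gt_2[of p] in_prime_factors_iff[of p n] by simp
qed

lemma jacobi_cong:
  assumes "[a = b] (mod int n)"
  shows "jacobi a n = jacobi b n"
  unfolding jacobi_prod
proof (rule prod.cong[OF refl])
  fix p assume "p \<in> prime_factors n"
  then have "int p dvd int n" by auto
  then show "Legendre a (int p) = Legendre b (int p)"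
    by (intro Legendre_cong cong_dvd_modulus[OF assms])
qed

lemma jacobi_eq_0_iff: "jacobi (int a) n = 0 \<longleftrightarrow> \<not> coprime a n"
proof -
  have "jacobi (int a) n = 0 \<longleftrightarrow> (\<exists>p\<in>prime_factors n. p dvd a)"
    unfolding jacobi_prod by (auto simp: Legendre_def cong_0_iff)
  also have "\<dots> \<longleftrightarrow> \<not> coprime a n"
  proof
    assume "\<exists>p\<in>prime_factors n. p dvd a"
    then obtain p where "prime p" "p dvd n" "p dvd a" by auto
    then show "\<not> coprime a n" using coprime_common_divisor not_prime_unit by blast
  next
    assume "\<not> coprime a n"
    then have "gcd a n \<noteq> 1" using gcd_eq_1_imp_coprime by blast
    then obtain p where "prime p" "p dvd gcd a n" using prime_factor_nat by blast
    then show "\<exists>p\<in>prime_factors n. p dvd a" using n_gt by (auto simp: in_prime_factors_iff)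
  qed
  finally show ?thesis .
qed

lemma jacobi_values: "jacobi a n \<in> {-1, 0, 1}"
proof -
  have "(\<Prod>p\<in>S. Legendre a (int p)) \<in> {-1, 0, 1}" if "finite S" for S
    using that
  proof induction
    case (insert p S)
    then show ?case using Legendre_values[of a "int p"] by auto
  qed simp
  then show ?thesis unfolding jacobi_prod by simp
qed

lemma jacobi_1: "jacobi 1 n = 1"
proof -
  have "jacobi (int 1) n \<noteq> 0" by (subst jacobi_eq_0_iff) simp
  moreover have "jacobi 1 n * jacobi 1 n = jacobi 1 n"
    using jacobi_mult[of 1 1] by simp
  ultimately show ?thesis by simp
qed

lemma jacobi_minus_one: "jacobi (- 1) n = gauss_s n"
proof -
  have *: "(\<Prod>p\<in>S. Legendre (-1) (int p)) = (-1) ^ ((\<Prod>S - 1) div 2) \<and> odd (\<Prod>S)"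
    if "finite S" "S \<subseteq> prime_factors n" for S
    using that
  proof induction
    case (insert p S)
    have p: "prime p" "2 < p" using insert.prems prime_factor_gt_2 by auto
    then have "odd p" using prime_odd_nat by blast
    then obtain i where i: "p = 2 * i + 1" by (auto elim: oddE)
    have IH: "(\<Prod>p\<in>S. Legendre (-1) (int p)) = (-1) ^ ((\<Prod>S - 1) div 2)" "odd (\<Prod>S)"
      using insert by auto
    then obtain j where j: "\<Prod>S = 2 * j + 1" by (auto elim: oddE)
    \<comment> \<open>Modulo 2 the exponents i and j add up, because their product enters with the
      factor 2.\<close>
    have "(p * \<Prod>S - 1) div 2 = 2 * (i * j) + i + j"
      unfolding i j by (simp add: algebra_simps)
    moreover have "(p - 1) div 2 = i" "(\<Prod>S - 1) div 2 = j" unfolding i j by auto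
    ultimately show ?case
      using insert.hyps IH Legendre_minus_one[OF p] \<open>odd p\<close>
      by (simp add: power_add power_mult)
  qed simp
  show ?thesis
    using *[of "prime_factors n"] n_prod unfolding jacobi_prod gauss_s_def by simp
qed

text \<open>The Chinese remainder theorem joins a nonresidue modulo p to 1 modulo
  \<open>n div p\<close>, so only the Legendre symbol at p is -1. Multiplication by such an a fixes
  every multiple of p modulo n, which later forces Gauss sums at arguments not coprime to n to
  vanish.\<close>

lemma jacobi_nonresidue_exists:
  assumes "p \<in> prime_factors n"
  shows "\<exists>a. coprime a n \<and> [a = 1] (mod n div p) \<and> jacobi (int a) n = - 1"
proof -
  have p: "prime p" "2 < p" "p dvd n" using assms prime_factor_gt_2 by auto
  obtain b where b: "coprime b p" "Legendre (int b) p = - 1"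
    using Legendre_nonresidue_exists p by blast
  have "coprime (n div p) p"
  proof (rule ccontr)
    assume "\<not> coprime (n div p) p"
    then have "p dvd n div p" using p prime_imp_coprime coprime_commute by blast
    then have "p ^ 2 dvd n" using p by (metis dvd_mult_div_cancel mult_dvd_mono dvd_refl power2_eq_square)
    then show False using n_squarefree p by (metis squarefree_def not_prime_unit)
  qed
  then obtain a where a: "[a = 1] (mod n div p)" "[a = b] (mod p)"
    using binary_chinese_remainder_nat by blast
  have "Legendre (int a) (int q) = (if q = p then -1 else 1)" if q: "q \<in> prime_factors n" for q
  proof (cases "q = p")
    case True
    then show ?thesis using Legendre_cong[of "int a" "int b" "int p"] a b by (simp add: cong_int_iff)
  next
    case False
    have "q dvd p * (n div p)" using q p by auto
    then have "q dvd n div p"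
      using q p False by (metis in_prime_factors_imp_prime prime_dvd_mult_iff primes_dvd_imp_eq)
    then have "[a = 1] (mod q)" using a cong_dvd_modulus_nat by blast
    then have "Legendre (int a) (int q) = Legendre 1 (int q)"
      using Legendre_cong[of "int a" "int 1" "int q"] cong_int_iff[of a 1 q] by simp
    also have "\<dots> = 1"
    proof -
      have "QuadRes (int q) 1" unfolding QuadRes_def by (rule exI[of _ 1]) simp
      moreover have "\<not> [1 = 0] (mod int q)"
        using prime_factor_gt_2[OF q] by (auto simp: cong_0_iff)
      ultimately show ?thesis by (simp add: Legendre_def)
    qed
    finally show ?thesis using False by simp
  qed
  then have "jacobi (int a) n = (\<Prod>q\<in>prime_factors n. if q = p then -1 else 1)"
    unfolding jacobi_prod by (intro prod.cong) auto
  also have "\<dots> = -1" using assms by (simp add: prod.delta)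
  finally have "jacobi (int a) n = - 1" .
  then show ?thesis using a jacobi_eq_0_iff[of a] by auto
qed

end

section \<open>Conjugates of roots of unity\<close>

lemma map_poly_of_int_add: "map_poly of_int (p + q) = (map_poly of_int p + map_poly of_int q :: complex poly)"
  by (intro poly_eqI) (simp add: coeff_map_poly)

lemma map_poly_of_int_diff: "map_poly of_int (p - q) = (map_poly of_int p - map_poly of_int q :: complex poly)"
  by (intro poly_eqI) (simp add: coeff_map_poly)

lemma map_poly_of_int_mult: "map_poly of_int (p * q) = (map_poly of_int p * map_poly of_int q :: complex poly)"
  by (intro poly_eqI) (simp add: coeff_map_poly coeff_mult)

lemma map_poly_of_int_smult: "map_poly of_int (Polynomial.smult c p) = (Polynomial.smult (of_int c) (map_poly of_int p) :: complex poly)"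
  by (intro poly_eqI) (simp add: coeff_map_poly)

lemma map_poly_of_int_monom: "map_poly of_int (Polynomial.monom c k) = (Polynomial.monom (of_int c) k :: complex poly)"
  by (intro poly_eqI) (simp add: coeff_map_poly)

lemma map_poly_of_int_1: "map_poly of_int 1 = (1 :: complex poly)"
  using map_poly_of_int_monom[of 1 0] by (simp flip: monom_0 one_poly_def)

lemma map_poly_of_int_pcompose:
  "map_poly of_int (p \<circ>\<^sub>p q) = (map_poly of_int p \<circ>\<^sub>p map_poly of_int q :: complex poly)"
proof (induction p)
  case (pCons a p)
  have "map_poly of_int (pCons a p \<circ>\<^sub>p q) = ([:of_int a:] + map_poly of_int q * map_poly of_int (p \<circ>\<^sub>p q) :: complex poly)"
    by (simp add: pcompose_pCons map_poly_of_int_add map_poly_of_int_mult map_poly_pCons)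
  then show ?case by (simp add: pCons.IH pcompose_pCons map_poly_pCons)
qed simp

lemmas map_poly_of_int_simps = map_poly_of_int_add map_poly_of_int_diff map_poly_of_int_mult
  map_poly_of_int_smult map_poly_of_int_monom map_poly_of_int_1 map_poly_of_int_pcompose

text \<open>The inner binomial coefficients are divisible by p. The ring is general because the
  summands will be polynomials.\<close>

lemma prime_dvd_add_power:
  fixes a b :: "'a :: comm_ring_1"
  assumes "prime p"
  shows "of_nat p dvd (a + b) ^ p - a ^ p - b ^ p"
proof -
  have p: "0 < p" using assms prime_gt_0_nat by blast
  have "(a + b) ^ p = (\<Sum>k\<le>p. of_nat (p choose k) * a ^ k * b ^ (p - k))"
    by (rule binomial_ring)
  also have "{..p} = insert 0 (insert p {0<..<p})" using p by auto
  also have "(\<Sum>k\<in>\<dots>. of_nat (p choose k) * a ^ k * b ^ (p - k)) =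
      b ^ p + (a ^ p + (\<Sum>k\<in>{0<..<p}. of_nat (p choose k) * a ^ k * b ^ (p - k)))"
    using p by simp
  finally have "(a + b) ^ p - a ^ p - b ^ p = (\<Sum>k\<in>{0<..<p}. of_nat (p choose k) * a ^ k * b ^ (p - k))"
    by (simp add: algebra_simps)
  also have "of_nat p dvd \<dots>"
  proof (rule dvd_sum)
    fix k assume "k \<in> {0<..<p}"
    then have "p dvd p choose k" using assms by (intro dvd_choose_prime) auto
    then have "of_nat p dvd (of_nat (p choose k) :: 'a)" by (metis dvdE dvd_triv_left of_nat_mult)
    then show "of_nat p dvd of_nat (p choose k) * a ^ k * b ^ (p - k)"
      by (simp add: dvd_mult2)
  qed
  finally show ?thesis .
qed

lemma prime_dvd_power_diff_self:
  fixes a :: int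
  assumes "prime p"
  shows "int p dvd a - a ^ p"
proof (cases "int p dvd a")
  case True
  then have "int p dvd a ^ p" using assms prime_gt_0_nat[of p] by (metis dvd_power dvd_trans)
  then show ?thesis using True by simp
next
  case False
  define b where "b = nat (a mod int p)"
  have p: "0 < p" using assms prime_gt_0_nat by blast
  have b: "int b = a mod int p" using p by (simp add: b_def)
  have "\<not> p dvd b"
    using False b by (metis dvd_mod_iff dvd_refl int_dvd_int_iff)
  then have "[b ^ (p - 1) = 1] (mod p)" using fermat_theorem assms by blast
  then have "[b ^ (p - 1) * b = 1 * b] (mod p)" by (rule cong_scalar_right)
  then have "[b ^ p = b] (mod p)" using p by (metis mult_1 power_minus_mult)
  then have "[int b ^ p = int b] (mod int p)" by (metis cong_int_iff of_nat_power)
  moreover have "[int b = a] (mod int p)" by (simp add: b cong_def)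
  ultimately have "[a ^ p = a] (mod int p)" by (meson cong_pow cong_sym cong_trans)
  then show ?thesis by (meson cong_iff_dvd_diff cong_sym)
qed

text \<open>Induction on the coefficients: for a constant this is Fermat's little theorem, and
  \<open>prime_dvd_add_power\<close> passes from the two summands of \<open>pCons a f\<close> to
  their sum.\<close>

lemma prime_dvd_poly_frobenius:
  fixes f :: "int poly"
  assumes "prime p"
  shows "of_nat p dvd f \<circ>\<^sub>p Polynomial.monom 1 p - f ^ p"
proof (induction f)
  case 0
  then show ?case using assms prime_gt_0_nat by (auto simp: power_0_left)
next
  case (pCons a f)
  let ?X = "Polynomial.monom 1 1 :: int poly"
  have X: "Polynomial.monom 1 p = ?X ^ p" by (simp add: monom_power)
  have dec: "pCons a f = [:a:] + ?X * f" by (simp add: monom_altdef)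
  have "pCons a f \<circ>\<^sub>p Polynomial.monom 1 p - pCons a f ^ p =
      ([:a:] - [:a:] ^ p) + ?X ^ p * (f \<circ>\<^sub>p Polynomial.monom 1 p - f ^ p)
      - (([:a:] + ?X * f) ^ p - [:a:] ^ p - (?X * f) ^ p)"
    unfolding pcompose_pCons X arg_cong[OF dec, of "\<lambda>q. q ^ p"]
    by (simp add: algebra_simps power_mult_distrib)
  moreover have "of_nat p dvd [:a:] - [:a:] ^ p"
  proof -
    obtain c where "a - a ^ p = int p * c" using prime_dvd_power_diff_self[OF assms, of a] by (elim dvdE)
    then have "[:a:] - [:a:] ^ p = of_nat p * [:c:]"
      by (simp add: poly_const_pow of_nat_poly)
    then show ?thesis by (rule dvdI)
  qed
  ultimately show ?case
    using prime_dvd_add_power[OF assms, of "[:a:]" "?X * f"] pCons.IH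
    by (simp only: dvd_add dvd_diff dvd_mult)
qed

text \<open>The witness is an annihilating polynomial of least degree, made primitive.
  Pseudo-division shows that it divides every other one over the rationals, and Gauss's lemma on
  primitive polynomials brings the quotient back to the integers.\<close>

lemma minimal_int_poly_exists:
  fixes w :: complex
  assumes "Q \<noteq> 0" "poly (map_poly of_int Q) w = 0"
  obtains f :: "int poly" where "f \<noteq> 0"
    "\<And>P. poly (map_poly of_int P) w = 0 \<longleftrightarrow> f dvd P"
proof -
  define ann where "ann P \<longleftrightarrow> P \<noteq> 0 \<and> poly (map_poly of_int P) w = 0" for P :: "int poly"
  obtain f0 where f0: "ann f0" "\<And>P. ann P \<Longrightarrow> degree f0 \<le> degree P"
    using ex_has_least_nat[of ann Q degree] assms unfolding ann_def by blast
  define f where "f = primitive_part f0"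
  have f0f: "f0 = Polynomial.smult (content f0) f" by (simp add: f_def)
  have cf: "content f = 1" using f0 by (simp add: f_def ann_def)
  have f: "f \<noteq> 0" "degree f = degree f0" using f0 by (simp_all add: f_def ann_def)
  have fw: "poly (map_poly of_int f) w = 0"
  proof -
    have "of_int (content f0) * poly (map_poly of_int f) w = 0"
      using f0 f0f unfolding ann_def by (metis map_poly_of_int_smult poly_smult)
    moreover have "content f0 \<noteq> 0" using f0 by (simp add: ann_def)
    ultimately show ?thesis by simp
  qed
  have "f dvd P" if P: "poly (map_poly of_int P) w = 0" for P
  proof -
    obtain a q where aq: "a \<noteq> 0" "Polynomial.smult a P = f * q + pseudo_mod P f"
      using pseudo_mod(1)[OF f(1)] by blast
    have "poly (map_poly of_int (pseudo_mod P f)) w = poly (map_poly of_int (Polynomial.smult a P - f * q)) w"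
      using aq by simp
    also have "\<dots> = 0" by (simp add: map_poly_of_int_simps P fw)
    finally have "pseudo_mod P f = 0"
      using pseudo_mod(2)[OF f(1), of P] f0(2)[of "pseudo_mod P f"] f(2)
      unfolding ann_def by linarith
    then have "fract_poly f dvd fract_poly (Polynomial.smult a P)" using aq by (intro fract_poly_dvd) simp
    then have "fract_poly f dvd fract_poly P" using aq(1) by (simp add: dvd_smult_iff)
    then show ?thesis using cf by (rule fract_poly_dvdD)
  qed
  moreover have "poly (map_poly of_int P) w = 0" if "f dvd P" for P
    using that fw by (auto simp: map_poly_of_int_simps elim!: dvdE)
  ultimately show ?thesis using that f by blast
qed

text \<open>If \<open>x ^ n - 1 = f g\<close> with \<open>f\<close> the minimal polynomial of \<open>w\<close> and \<open>g (w ^ p) = 0\<close>, then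
  \<open>f\<close> divides \<open>g (x ^ p)\<close>, and differentiating shows \<open>n = 0\<close> in the quotient by \<open>f\<close> and \<open>p\<close>.\<close>

lemma int_poly_root_of_unity_power_prime:
  fixes w :: complex and P :: "int poly"
  assumes n: "n > 0" "w ^ n = 1" and p: "prime p" "\<not> p dvd n"
    and P: "poly (map_poly of_int P) w = 0"
  shows "poly (map_poly of_int P) (w ^ p) = 0"
proof (rule ccontr)
  assume contra: "poly (map_poly of_int P) (w ^ p) \<noteq> 0"
  define Q :: "int poly" where "Q = Polynomial.monom 1 n - 1"
  have evQ: "poly (map_poly of_int Q) x = x ^ n - 1" for x :: complex
    by (simp add: Q_def map_poly_of_int_simps poly_monom)
  have degQ: "degree Q = n" "lead_coeff Q = 1"
  proof -
    have "degree (Polynomial.monom 1 n - 1 :: int poly) = degree (Polynomial.monom 1 n :: int poly)"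
      using n degree_add_eq_left[of "-1" "Polynomial.monom (1 :: int) n"] by (simp add: degree_monom_eq)
    then show "degree Q = n" by (simp add: Q_def degree_monom_eq)
    then show "lead_coeff Q = 1" using n by (simp add: Q_def)
  qed
  then have "Q \<noteq> 0" by auto
  then obtain f where f: "f \<noteq> 0" "\<And>P. poly (map_poly of_int P) w = 0 \<longleftrightarrow> f dvd P"
    using minimal_int_poly_exists[of Q w] n evQ by auto
  obtain g where g: "Q = f * g" using f(2)[of Q] evQ n by auto
  \<comment> \<open>\<open>Q\<close> is monic, so the leading coefficient of its factor
    \<open>f\<close> is a unit; this later allows division with remainder by \<open>f\<close> over
    the integers.\<close>
  have lcf: "lead_coeff f dvd 1"
    using degQ(2) unfolding g lead_coeff_mult by (metis dvd_triv_left)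
  have degf: "degree f > 0"
  proof (rule ccontr)
    assume "\<not> degree f > 0"
    then obtain c where c: "f = [:c:]" by (meson degree_eq_zeroE neq0_conv)
    have "poly (map_poly of_int f) w = 0" using f(2)[of f] by simp
    then show False using f(1) c by (simp add: map_poly_pCons)
  qed
  let ?Xp = "Polynomial.monom 1 p :: int poly"
  have ev_comp: "poly (map_poly of_int (h \<circ>\<^sub>p ?Xp)) w = poly (map_poly of_int h) (w ^ p)" for h
    by (simp add: map_poly_of_int_simps poly_pcompose poly_monom)
  have "poly (map_poly of_int f) (w ^ p) \<noteq> 0"
    using contra f(2)[of P] P by (auto simp: map_poly_of_int_simps elim!: dvdE)
  moreover have "poly (map_poly of_int f) (w ^ p) * poly (map_poly of_int g) (w ^ p) = 0"
    using evQ[of "w ^ p"] n unfolding g by (simp add: map_poly_of_int_simps power_commutes flip: power_mult)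
       (metis mult.commute power_mult power_one)
  ultimately have "poly (map_poly of_int (g \<circ>\<^sub>p ?Xp)) w = 0" by (simp add: ev_comp)
  then obtain u where u: "g \<circ>\<^sub>p ?Xp = f * u" using f(2) by (metis dvdE)
  obtain v where v: "f \<circ>\<^sub>p ?Xp - f ^ p = of_nat p * v"
    using prime_dvd_poly_frobenius[OF p(1), of f] by (elim dvdE)
  obtain e where e: "p = Suc e" using p(1) prime_gt_0_nat by (metis Suc_pred)
  have "pderiv Q = Polynomial.monom (int n) (n - 1)"
    by (simp add: Q_def pderiv_diff pderiv_monom)
  then have "Polynomial.monom (int n) (n - 1) = pderiv f * g + f * pderiv g"
    by (simp add: g pderiv_mult ac_simps)
  then have "Polynomial.monom (int n) (n - 1) \<circ>\<^sub>p ?Xp = (pderiv f * g + f * pderiv g) \<circ>\<^sub>p ?Xp" by simp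
  also have "\<dots> = (pderiv f \<circ>\<^sub>p ?Xp) * (f * u) + (f ^ p + of_nat p * v) * (pderiv g \<circ>\<^sub>p ?Xp)"
    using v by (simp add: pcompose_add pcompose_mult u algebra_simps)
  also have "\<dots> = f * ((pderiv f \<circ>\<^sub>p ?Xp) * u + f ^ e * (pderiv g \<circ>\<^sub>p ?Xp))
      + of_nat p * (v * (pderiv g \<circ>\<^sub>p ?Xp))"
    by (simp add: e algebra_simps)
  finally obtain U V where UV: "Polynomial.monom (int n) (n - 1) \<circ>\<^sub>p ?Xp = f * U + of_nat p * V" by blast
  \<comment> \<open>Multiplying by \<open>x ^ p\<close> turns the exponent
    \<open>(n - 1) * p\<close> into \<open>n * p\<close>, and \<open>x ^ (n * p)\<close> is 1 modulo
    \<open>f\<close>. Modulo \<open>f\<close>, the left side thus becomes the constant n.\<close>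
  have "Polynomial.monom (int n) (n - 1) \<circ>\<^sub>p ?Xp * ?Xp = of_nat n * Polynomial.monom 1 (n * p)"
  proof -
    have "Polynomial.monom (int n) (n - 1) = of_nat n * Polynomial.monom 1 (n - 1)"
      by (simp add: of_nat_poly smult_monom)
    moreover have "Polynomial.monom 1 m \<circ>\<^sub>p ?Xp = ?Xp ^ m" for m
      by (induction m) (simp_all add: monom_Suc pcompose_pCons one_pCons)
    moreover have "?Xp ^ (n - 1) * ?Xp = ?Xp ^ n" using power_minus_mult[OF n(1)] .
    moreover have "?Xp ^ n = Polynomial.monom 1 (n * p)" by (simp add: monom_power mult.commute)
    moreover have "(of_nat n :: int poly) \<circ>\<^sub>p ?Xp = of_nat n" by (simp add: of_nat_poly)
    ultimately show ?thesis by (simp add: pcompose_mult mult.assoc)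
  qed
  moreover have "f dvd Polynomial.monom 1 (n * p) - 1"
  proof -
    have "poly (map_poly of_int (Polynomial.monom 1 (n * p) - 1)) w = 0"
      using n by (simp add: map_poly_of_int_simps poly_monom power_mult)
    then show ?thesis using f(2) by blast
  qed
  then obtain k where k: "Polynomial.monom 1 (n * p) = f * k + 1" by (metis add.commute diff_add_cancel dvdE)
  ultimately have "(f * U + of_nat p * V) * ?Xp = of_nat n * (f * k + 1)" using UV by simp
  then have main: "of_nat n = f * (U * ?Xp - of_nat n * k) + of_nat p * (V * ?Xp)"
    by (simp add: algebra_simps)
  \<comment> \<open>Pseudo-division scales by a power of the leading coefficient of
    \<open>f\<close>, so \<open>a\<close> is a unit. The cofactor of p is reduced to a degree below
    that of \<open>f\<close>.\<close>
  obtain a b where ab: "a dvd 1" "Polynomial.smult a (V * ?Xp) = f * b + pseudo_mod (V * ?Xp) f"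
    "pseudo_mod (V * ?Xp) f = 0 \<or> degree (pseudo_mod (V * ?Xp) f) < degree f"
  proof -
    obtain q r where qr: "pseudo_divmod (V * ?Xp) f = (q, r)" by fastforce
    then have "pseudo_mod (V * ?Xp) f = r" by (simp add: pseudo_mod_def)
    moreover have "lead_coeff f ^ k dvd 1" for k using lcf is_unit_power_iff by blast
    ultimately show ?thesis using pseudo_divmod[OF f(1) qr] that by metis
  qed
  define r where "r = pseudo_mod (V * ?Xp) f"
  have "Polynomial.smult a (of_nat n) = Polynomial.smult a (f * (U * ?Xp - of_nat n * k)) + of_nat p * Polynomial.smult a (V * ?Xp)"
    using arg_cong[OF main, of "Polynomial.smult a"] by (simp add: smult_add_right)
  also have "\<dots> = f * (Polynomial.smult a (U * ?Xp - of_nat n * k) + of_nat p * b) + of_nat p * r"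
    unfolding ab(2) r_def by (simp add: algebra_simps)
  finally obtain c where c: "Polynomial.smult a (of_nat n) = f * c + of_nat p * r" by blast
  \<comment> \<open>A nonzero \<open>c\<close> would give \<open>f * c\<close> at least the degree
    of \<open>f\<close>, but both other terms have smaller degree. With \<open>c = 0\<close>,
    evaluation at 0 shows that p divides \<open>a * n\<close>.\<close>
  have "c = 0"
  proof (rule ccontr)
    assume "c \<noteq> 0"
    then have "degree (f * c) \<ge> degree f" using f(1) by (simp add: degree_mult_eq)
    moreover have "f * c = Polynomial.smult a (of_nat n) - of_nat p * r" using c by simp
    moreover have "degree (Polynomial.smult a (of_nat n) - of_nat p * r) < degree f"
    proof (rule degree_diff_less)
      show "degree (Polynomial.smult a (of_nat n)) < degree f" using degf by (simp add: of_nat_poly)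
      show "degree (of_nat p * r) < degree f"
        using ab(3) degf by (auto simp: r_def of_nat_poly intro: le_less_trans[OF degree_smult_le])
    qed
    ultimately show False by simp
  qed
  then have "Polynomial.smult a (of_nat n) = of_nat p * r" using c by simp
  then have "poly (Polynomial.smult a (of_nat n)) 0 = poly (of_nat p * r) 0" by (rule arg_cong)
  then have "a * int n = int p * poly r 0" by simp
  then have "int p dvd a * int n" by simp
  then have "int p dvd int n" using ab(1) by (metis dvd_mult_unit_iff' mult.commute)
  then show False using p by simp
qed

text \<open>Induction on the prime factorization of k; \<open>w\<close> is generalized because each
  prime replaces it by \<open>w ^ p\<close>. This is the irreducibility of the cyclotomic polynomial
  in the form used below.\<close>

theorem int_poly_root_of_unity_power:
  fixes w :: complex and P :: "int poly"
  assumes "n > 0" "w ^ n = 1" "coprime k n" "poly (map_poly of_int P) w = 0"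
  shows "poly (map_poly of_int P) (w ^ k) = 0"
  using assms(2-)
proof (induction k arbitrary: w rule: prime_divisors_induct)
  \<comment> \<open>Only n = 1 is coprime to 0, and then w = 1.\<close>
  case zero
  then show ?case by simp
next
  case (unit x)
  then show ?case by simp
next
  case (factor p k)
  have "\<not> p dvd n" using factor by (meson coprime_common_divisor dvd_triv_left not_prime_unit)
  then have "poly (map_poly of_int P) (w ^ p) = 0"
    using int_poly_root_of_unity_power_prime factor assms(1) by blast
  moreover have "(w ^ p) ^ n = 1" using factor by (metis mult.commute power_mult power_one)
  ultimately show ?case using factor by (simp add: power_mult)
qed

section \<open>The logarithmic series on the closed disc\<close>

text \<open>Multiplication by 1 - z produces the differences of 1/(j+1) and 1/(j+2) as coefficients.
  Their series converges absolutely on the closed disc, and the last term tends to 0 there.\<close>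

lemma log_series_summation_by_parts:
  fixes z :: complex
  shows "(1 - z) * (\<Sum>j<Suc N. z ^ Suc j / of_nat (Suc j)) =
    z - (\<Sum>j<N. z ^ (j + 2) / of_nat (Suc j * (j + 2))) - z ^ (N + 2) / of_nat (Suc N)"
proof (induction N)
  case 0
  then show ?case by (simp add: algebra_simps power2_eq_square)
next
  case (Suc N)
  define c where "c = (of_nat N :: complex)"
  have nz: "1 + c \<noteq> 0" "2 + c \<noteq> 0"
    unfolding c_def using of_nat_neq_0[of N, where 'a = complex] of_nat_neq_0[of "Suc N", where 'a = complex]
    by (simp_all add: add.commute)
  define y where "y = z ^ (N + 2)"
  have "(1 - z) * (\<Sum>j<Suc (Suc N). z ^ Suc j / of_nat (Suc j)) =
      z - (\<Sum>j<N. z ^ (j + 2) / of_nat (Suc j * (j + 2))) - y / (1 + c) + (1 - z) * (y / (2 + c))"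
    using Suc.IH by (simp add: distrib_left c_def y_def del: of_nat_mult)
  also have "- y / (1 + c) + (1 - z) * (y / (2 + c)) = - y / ((1 + c) * (2 + c)) - z * y / (2 + c)"
    using nz by (simp add: divide_simps) (simp add: algebra_simps)
  then have "z - (\<Sum>j<N. z ^ (j + 2) / of_nat (Suc j * (j + 2))) - y / (1 + c) + (1 - z) * (y / (2 + c)) =
    z - (\<Sum>j<N. z ^ (j + 2) / of_nat (Suc j * (j + 2))) - y / ((1 + c) * (2 + c)) - z * y / (2 + c)"
    by (simp add: algebra_simps)
  finally show ?case by (simp add: c_def y_def algebra_simps)
qed

text \<open>This keeps 1 - z off the branch cut of \<open>Ln\<close> at the boundary points as
  well.\<close>

lemma Re_one_minus_pos:
  fixes z :: complex
  assumes "norm z \<le> 1" "z \<noteq> 1"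
  shows "0 < Re (1 - z)"
proof (rule ccontr)
  assume "\<not> 0 < Re (1 - z)"
  then have "Re z \<ge> 1" by simp
  then have re: "Re z = 1" using assms(1) complex_Re_le_cmod[of z] by simp
  then have "(Re z)\<^sup>2 + (Im z)\<^sup>2 \<le> 1"
    using assms(1) by (metis cmod_power2 norm_ge_zero power_le_one)
  then have "Im z = 0" using re by simp
  then show False using re assms(2) by (simp add: complex_eq_iff)
qed

text \<open>Summation by parts replaces the series by an absolutely convergent one, which is continuous
  on the closed disc; this gives the boundary values.\<close>

lemma log_series_sums:
  fixes z :: complex
  assumes "norm z \<le> 1" "z \<noteq> 1"
  shows "(\<lambda>j. z ^ Suc j / of_nat (Suc j)) sums (- Ln (1 - z))"
proof -
  define c where "c j = (1 / of_nat (Suc j * (j + 2)) :: real)" for j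
  define H where "H x = (\<Sum>j. x ^ (j + 2) / of_nat (Suc j * (j + 2)))" for x :: complex
  have sc: "summable c"
  proof (rule summable_comparison_test)
    show "\<exists>N. \<forall>j\<ge>N. norm (c j) \<le> inverse (real (Suc j) ^ 2)"
    proof (intro exI allI impI)
      fix j :: nat
      have "real (Suc j) ^ 2 \<le> real (Suc j * (j + 2))" by (simp add: power2_eq_square algebra_simps)
      then show "norm (c j) \<le> inverse (real (Suc j) ^ 2)"
        by (simp add: c_def divide_simps del: of_nat_mult of_nat_Suc)
    qed
    show "summable (\<lambda>j. inverse (real (Suc j) ^ 2))"
      using inverse_power_summable[of 2, where 'a = real] by (subst summable_Suc_iff) simp
  qed
  have bound: "norm (x ^ (j + 2) / of_nat (Suc j * (j + 2))) \<le> c j" if "norm x \<le> 1" for x :: complex and j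
  proof -
    have "norm (x ^ (j + 2)) \<le> 1" using that by (metis norm_ge_zero norm_power power_le_one)
    then show ?thesis by (simp add: c_def norm_divide divide_right_mono del: of_nat_mult of_nat_Suc power_Suc)
  qed
  have lim: "(\<lambda>N. \<Sum>j<N. x ^ Suc j / of_nat (Suc j)) \<longlonglongrightarrow> (x - H x) / (1 - x)"
    if x: "norm x \<le> 1" "x \<noteq> 1" for x :: complex
  proof -
    have "summable (\<lambda>j. x ^ (j + 2) / of_nat (Suc j * (j + 2)))"
      by (rule summable_comparison_test'[OF sc, of 0]) (use bound x in blast)
    then have "(\<lambda>N. \<Sum>j<N. x ^ (j + 2) / of_nat (Suc j * (j + 2))) \<longlonglongrightarrow> H x"
      unfolding H_def by (rule summable_LIMSEQ)
    moreover have "(\<lambda>N. x ^ (N + 2) / of_nat (Suc N)) \<longlonglongrightarrow> 0"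
    proof (rule Lim_null_comparison)
      show "\<forall>\<^sub>F N in sequentially. norm (x ^ (N + 2) / of_nat (Suc N)) \<le> inverse (real (Suc N))"
      proof (intro always_eventually allI)
        fix N
        have "norm (x ^ (N + 2)) \<le> 1" using x by (metis norm_ge_zero norm_power power_le_one)
        then show "norm (x ^ (N + 2) / of_nat (Suc N)) \<le> inverse (real (Suc N))"
          by (simp add: norm_divide divide_simps del: of_nat_Suc power_Suc power_add)
      qed
      show "(\<lambda>N. inverse (real (Suc N))) \<longlonglongrightarrow> 0" by (rule LIMSEQ_inverse_real_of_nat)
    qed
    ultimately have "(\<lambda>N. x - (\<Sum>j<N. x ^ (j + 2) / of_nat (Suc j * (j + 2))) - x ^ (N + 2) / of_nat (Suc N))
        \<longlonglongrightarrow> x - H x - 0"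
      by (intro tendsto_intros)
    then have "(\<lambda>N. (1 - x) * (\<Sum>j<Suc N. x ^ Suc j / of_nat (Suc j))) \<longlonglongrightarrow> x - H x"
      unfolding log_series_summation_by_parts by simp
    then have "(\<lambda>N. (1 - x) * (\<Sum>j<Suc N. x ^ Suc j / of_nat (Suc j)) / (1 - x)) \<longlonglongrightarrow> (x - H x) / (1 - x)"
      using x by (intro tendsto_divide tendsto_const) auto
    then have "(\<lambda>N. \<Sum>j<Suc N. x ^ Suc j / of_nat (Suc j)) \<longlonglongrightarrow> (x - H x) / (1 - x)"
      using x by (simp del: sum.lessThan_Suc)
    then show ?thesis by (subst (asm) filterlim_sequentially_Suc)
  qed
  \<comment> \<open>In the open disc the known power series of the logarithm gives the value of
    \<open>H\<close>.\<close>
  have inner: "x - H x = - (1 - x) * Ln (1 - x)" if x: "norm x < 1" for x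
  proof -
    have "x \<noteq> 1" using x by auto
    have "(\<lambda>j. - (x ^ j) / of_nat j) sums Ln (1 - x)"
      using Ln_series'[of "- x"] x by simp
    then have "(\<lambda>j. - (x ^ Suc j) / of_nat (Suc j)) sums (Ln (1 - x))"
      by (subst sums_Suc_iff) simp
    from sums_minus[OF this] have "(\<lambda>j. x ^ Suc j / of_nat (Suc j)) sums (- Ln (1 - x))"
      by (simp del: of_nat_Suc)
    then have "(x - H x) / (1 - x) = - Ln (1 - x)"
      unfolding sums_def using lim[of x] x \<open>x \<noteq> 1\<close> LIMSEQ_unique by (metis less_imp_le)
    then show ?thesis using \<open>x \<noteq> 1\<close> by (simp add: field_simps)
  qed
  have contH: "continuous_on (cball 0 1) H"
  proof -
    have ul: "uniform_limit (cball 0 1) (\<lambda>N x. \<Sum>j<N. x ^ (j + 2) / of_nat (Suc j * (j + 2))) H sequentially"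
      unfolding H_def by (rule Weierstrass_m_test[OF _ sc]) (use bound in \<open>simp only: mem_cball dist_0_norm\<close>)
    have "of_nat (Suc j * (j + 2)) \<noteq> (0 :: complex)" for j
      by (simp only: of_nat_eq_0_iff) simp
    then have "continuous_on (cball 0 1) (\<lambda>x :: complex. \<Sum>j<N. x ^ (j + 2) / of_nat (Suc j * (j + 2)))" for N
      by (intro continuous_intros) blast
    then have "\<forall>\<^sub>F N in sequentially. continuous_on (cball 0 1)
        (\<lambda>x :: complex. \<Sum>j<N. x ^ (j + 2) / of_nat (Suc j * (j + 2)))"
      by (simp only: eventually_True)
    then show ?thesis by (rule uniform_limit_theorem[OF _ ul trivial_limit_sequentially])
  qed
  \<comment> \<open>The point z is approached along its radius. Both sides of \<open>inner\<close>
    are continuous there, so the identity passes to the limit.\<close>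
  define r where "r N = real N / real (Suc N)" for N
  have r: "r \<longlonglongrightarrow> 1" unfolding r_def by (rule LIMSEQ_n_over_Suc_n)
  have r01: "0 \<le> r N" "r N < 1" for N by (simp_all add: r_def)
  have rz: "norm (of_real (r N) * z) < 1" for N
    using assms(1) r01[of N] by (simp add: norm_mult)
       (metis abs_of_nonneg le_less_trans mult.right_neutral mult_left_mono)
  have rzlim: "(\<lambda>N. of_real (r N) * z) \<longlonglongrightarrow> z"
    using tendsto_mult_right[OF tendsto_of_real[OF r], of z] by simp
  have "(\<lambda>N. H (of_real (r N) * z)) \<longlonglongrightarrow> H z"
    by (rule continuous_on_tendsto_compose[OF contH rzlim])
       (use assms(1) rz in \<open>auto intro!: always_eventually less_imp_le\<close>)
  then have "(\<lambda>N. of_real (r N) * z - H (of_real (r N) * z)) \<longlonglongrightarrow> z - H z"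
    by (intro tendsto_diff rzlim)
  moreover have "(\<lambda>N. - (1 - of_real (r N) * z) * Ln (1 - of_real (r N) * z)) \<longlonglongrightarrow> - (1 - z) * Ln (1 - z)"
  proof -
    have "1 - z \<notin> \<real>\<^sub>\<le>\<^sub>0" using Re_one_minus_pos[OF assms] by (auto simp: complex_nonpos_Reals_iff)
    then show ?thesis by (intro tendsto_intros rzlim)
  qed
  ultimately have "z - H z = - (1 - z) * Ln (1 - z)"
    using inner[OF rz] by (simp add: LIMSEQ_unique)
  then have "(z - H z) / (1 - z) = - Ln (1 - z)" using assms by (simp add: field_simps)
  then show ?thesis unfolding sums_def using lim[OF assms] by simp
qed

section \<open>Gauss sums\<close>

context odd_squarefree
begin

definition zeta :: complex where "zeta = cis (2 * pi / real n)"

definition chi :: "nat \<Rightarrow> complex" where "chi k = of_int (jacobi (int k) n)"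

definition gauss_sum :: "nat \<Rightarrow> complex" where "gauss_sum j = (\<Sum>k<n. chi k * zeta ^ (j * k))"

definition tau :: complex where "tau = gauss_sum 1"

text \<open>Used with e = 1 and e = -1. A complex index lets \<open>of_int (gauss_s n) * e\<close>
  name the class onto which negation maps the class of e.\<close>

definition chi_level :: "complex \<Rightarrow> nat set" where "chi_level e = {k. k < n \<and> chi k = e}"

lemma zeta_power: "zeta ^ k = cis (2 * pi * real k / real n)"
  unfolding zeta_def Complex.DeMoivre by (simp add: mult_ac)

lemma zeta_power_eq_1_iff: "zeta ^ k = 1 \<longleftrightarrow> n dvd k"
proof -
  have "zeta ^ k = exp (2 * of_real pi * \<i> * of_nat k / of_nat n)"
    by (simp add: zeta_power cis_conv_exp mult_ac)
  then show ?thesis using complex_root_unity_eq_1[of n k] n_gt by simp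
qed

lemma zeta_nz: "zeta \<noteq> 0" by (simp add: zeta_def)

lemma zeta_power_n: "zeta ^ n = 1" by (simp add: zeta_power_eq_1_iff)

lemma zeta_power_mod: "zeta ^ (k mod n) = zeta ^ k"
proof -
  have "zeta ^ k = zeta ^ (n * (k div n) + k mod n)" by simp
  also have "\<dots> = zeta ^ (k mod n)" by (simp only: power_add power_mult zeta_power_n power_one mult_1)
  finally show ?thesis ..
qed

lemma zeta_power_cong: "[j = k] (mod n) \<Longrightarrow> zeta ^ j = zeta ^ k"
  by (metis zeta_power_mod cong_def)

lemma zeta_power_eq_iff: "zeta ^ j = zeta ^ k \<longleftrightarrow> [j = k] (mod n)"
proof
  have *: "[j = k] (mod n)" if "zeta ^ j = zeta ^ k" "k \<le> j" for j k
  proof -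
    have "zeta ^ k * zeta ^ (j - k) = zeta ^ k * 1"
      using that by (simp flip: power_add)
    then have "zeta ^ (j - k) = 1" using zeta_nz by simp
    then show ?thesis using that zeta_power_eq_1_iff by (simp add: cong_altdef_nat)
  qed
  show "[j = k] (mod n)" if "zeta ^ j = zeta ^ k"
    using *[of j k] *[of k j] that by (metis cong_sym nat_le_linear)
qed (rule zeta_power_cong)

lemma norm_zeta_power [simp]: "norm (zeta ^ k) = 1" by (simp add: zeta_power)

lemma sum_zeta_power: "(\<Sum>k<n. zeta ^ (j * k)) = (if n dvd j then of_nat n else 0)"
proof (cases "n dvd j")
  case True
  then have "zeta ^ (j * k) = 1" for k using zeta_power_eq_1_iff by simp
  then show ?thesis using True by simp
next
  case False
  then have "zeta ^ j \<noteq> 1" using zeta_power_eq_1_iff by simp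
  then have "(\<Sum>k<n. (zeta ^ j) ^ k) = ((zeta ^ j) ^ n - 1) / (zeta ^ j - 1)"
    by (rule geometric_sum)
  also have "(zeta ^ j) ^ n = 1" by (metis zeta_power_n mult.commute power_mult power_one)
  finally show ?thesis using False by (simp add: power_mult)
qed

lemma chi_mult: "chi (a * b) = chi a * chi b"
  by (simp add: chi_def jacobi_mult)

lemma chi_cong: "[a = b] (mod n) \<Longrightarrow> chi a = chi b"
  using jacobi_cong[of "int a" "int b"] by (simp add: chi_def cong_int_iff)

lemma chi_mod: "chi (k mod n) = chi k"
  by (rule chi_cong) simp

lemma chi_1 [simp]: "chi 1 = 1" "chi (Suc 0) = 1"
  using jacobi_1 by (simp_all add: chi_def)

lemma chi_eq_0_iff: "chi k = 0 \<longleftrightarrow> \<not> coprime k n"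
  using jacobi_eq_0_iff[of k] by (simp add: chi_def)

lemma chi_0 [simp]: "chi 0 = 0" using n_gt by (simp add: chi_eq_0_iff)

lemma chi_cases: "chi k = 0 \<or> chi k = 1 \<or> chi k = -1"
  using jacobi_values[of "int k"] by (auto simp: chi_def)

lemma chi_square: "coprime k n \<Longrightarrow> chi k * chi k = 1"
  using chi_cases[of k] chi_eq_0_iff[of k] by auto

lemma chi_minus: "k \<le> n \<Longrightarrow> chi (n - k) = of_int (gauss_s n) * chi k"
proof -
  assume "k \<le> n"
  have "[int (n - k) = - 1 * int k] (mod int n)"
    using \<open>k \<le> n\<close> by (simp add: of_nat_diff cong_iff_dvd_diff)
  then have "jacobi (int (n - k)) n = jacobi (- 1) n * jacobi (int k) n"
    using jacobi_cong jacobi_mult by metis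
  then show ?thesis by (simp add: chi_def jacobi_minus_one)
qed

lemma bij_betw_mult_mod:
  assumes "coprime a n"
  shows "bij_betw (\<lambda>k. a * k mod n) {..<n} {..<n}"
proof -
  have "inj_on (\<lambda>k. a * k mod n) {..<n}"
  proof (rule inj_onI)
    fix x y assume xy: "x \<in> {..<n}" "y \<in> {..<n}" "a * x mod n = a * y mod n"
    then have "[a * x = a * y] (mod n)" by (simp add: cong_def)
    then have "[x = y] (mod n)" using assms cong_mult_lcancel_nat by blast
    then show "x = y" using xy by (simp add: cong_def)
  qed
  moreover have "(\<lambda>k. a * k mod n) ` {..<n} \<subseteq> {..<n}" using n_gt by auto
  ultimately show ?thesis
    by (simp add: bij_betw_def endo_inj_surj)
qed

lemma sum_mult_mod:
  assumes "coprime a n"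
  shows "(\<Sum>k<n. F (a * k mod n)) = (\<Sum>k<n. F k)"
  using sum.reindex_bij_betw[OF bij_betw_mult_mod[OF assms], of F] .

text \<open>Substituting \<open>a * k\<close> for k permutes the residues modulo n.\<close>

lemma chi_mult_gauss_sum:
  assumes "coprime a n"
  shows "chi a * gauss_sum (j * a) = gauss_sum j"
proof -
  have "gauss_sum j = (\<Sum>k<n. chi (a * k mod n) * zeta ^ (j * (a * k mod n)))"
    unfolding gauss_sum_def using sum_mult_mod[OF assms, of "\<lambda>k. chi k * zeta ^ (j * k)"] by simp
  also have "\<dots> = (\<Sum>k<n. chi a * (chi k * zeta ^ (j * a * k)))"
  proof (rule sum.cong[OF refl])
    fix k
    have "zeta ^ (j * (a * k mod n)) = zeta ^ (j * a * k)"
      by (rule zeta_power_cong) (metis cong_mod_left cong_refl cong_scalar_left mult.assoc)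
    then show "chi (a * k mod n) * zeta ^ (j * (a * k mod n)) = chi a * (chi k * zeta ^ (j * a * k))"
      by (simp add: chi_mod chi_mult)
  qed
  finally show ?thesis by (simp add: gauss_sum_def sum_distrib_left)
qed

text \<open>For j coprime to n this is a substitution together with
  \<open>chi j * chi j = 1\<close>. Otherwise a common prime factor p supplies an a with
  \<open>chi a = - 1\<close> and \<open>j * a\<close> congruent to j, so the sum equals its own
  negative.\<close>

lemma gauss_sum_separable: "gauss_sum j = chi j * tau"
proof (cases "coprime j n")
  case True
  then have "chi j * gauss_sum j = tau" using chi_mult_gauss_sum[of j 1] by (simp add: tau_def)
  then show ?thesis using chi_square[OF True] by (metis mult.assoc mult_1)
next
  case False
  then obtain p where p: "prime p" "p dvd j" "p dvd n"
    by (metis gcd_eq_1_imp_coprime prime_factor_nat dvd_trans gcd_dvd1 gcd_dvd2)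
  then have "p \<in> prime_factors n" using n_gt by (simp add: in_prime_factors_iff)
  then obtain a where a: "coprime a n" "[a = 1] (mod n div p)" "jacobi (int a) n = - 1"
    using jacobi_nonresidue_exists by blast
  obtain i where i: "j = p * i" using p by blast
  \<comment> \<open>The factor p of j makes up for the factor missing in the modulus
    \<open>n div p\<close>.\<close>
  have "[p * a = p * 1] (mod p * (n div p))" using a(2) by (simp add: cong_def mod_mult_mult1)
  then have "[p * a = p * 1] (mod n)" using p by simp
  then have "[i * (p * a) = i * (p * 1)] (mod n)" by (rule cong_scalar_left)
  then have ja: "[j * a = j] (mod n)" using i by (simp add: mult_ac)
  have "gauss_sum (j * a) = gauss_sum j"
    unfolding gauss_sum_def
    by (intro sum.cong refl arg_cong2[where f = "(*)"] zeta_power_cong cong_mult ja cong_refl)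
  then have "- gauss_sum j = gauss_sum j"
    using chi_mult_gauss_sum[OF a(1), of j] a(3) by (simp add: chi_def)
  then show ?thesis using False chi_eq_0_iff[of j] by simp
qed

text \<open>The sum of \<open>gauss_sum j\<close> times the inverse of \<open>zeta ^ j\<close> is
  computed twice: separability gives s times the square of tau, and exchanging the sums leaves only
  the term k = 1, with value n. The exponent \<open>n - 1\<close> stands for -1.\<close>

lemma tau_square: "tau\<^sup>2 = of_int (gauss_s n * int n)"
proof -
  have s: "(of_int (gauss_s n) :: complex) * of_int (gauss_s n) = 1"
    by (simp add: gauss_s_def flip: power_mult_distrib)
  have chim: "chi (n - 1) = of_int (gauss_s n)" using chi_minus[of 1] n_gt by simp
  have "(\<Sum>j<n. gauss_sum j * zeta ^ (j * (n - 1))) = tau * (\<Sum>j<n. chi j * zeta ^ ((n - 1) * j))"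
    by (simp add: gauss_sum_separable sum_distrib_left mult_ac)
  also have "\<dots> = tau * gauss_sum (n - 1)" by (simp only: gauss_sum_def)
  also have "\<dots> = of_int (gauss_s n) * tau\<^sup>2"
    using gauss_sum_separable[of "n - 1"] chim by (simp add: power2_eq_square)
  finally have "of_int (gauss_s n) * tau\<^sup>2 = (\<Sum>j<n. \<Sum>k<n. chi k * zeta ^ ((k + n - 1) * j))"
    using n_gt by (simp add: gauss_sum_def sum_distrib_right sum_distrib_left algebra_simps flip: power_add)
  also have "\<dots> = (\<Sum>k<n. chi k * (\<Sum>j<n. zeta ^ ((k + n - 1) * j)))"
    by (subst sum.swap) (simp add: sum_distrib_left)
  also have "\<dots> = (\<Sum>k<n. if k = 1 then of_nat n else 0)"
  proof (rule sum.cong[OF refl])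
    fix k assume "k \<in> {..<n}"
    moreover have "n dvd k + n - 1 \<longleftrightarrow> k = 1" if "k < n"
    proof
      assume dvd: "n dvd k + n - 1"
      show "k = 1"
      proof (cases "k = 0")
        case True
        then show ?thesis using dvd n_gt by (simp add: nat_dvd_not_less)
      next
        case False
        then have "k + n - 1 = (k - 1) + n" by simp
        then have "n dvd k - 1" using dvd by simp
        then show ?thesis using that False by (metis One_nat_def Suc_pred diff_less dvd_imp_le less_le_trans neq0_conv not_less zero_less_one less_imp_le_nat le_less_trans diff_le_self)
      qed
    qed simp
    ultimately show "chi k * (\<Sum>j<n. zeta ^ ((k + n - 1) * j)) = (if k = 1 then of_nat n else 0)"
      by (simp add: sum_zeta_power)
  qed
  also have "\<dots> = of_nat n" using n_gt by (simp add: sum.delta)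
  finally have "of_int (gauss_s n) * (of_int (gauss_s n) * tau\<^sup>2) = of_int (gauss_s n) * of_nat n" by simp
  then show ?thesis using s by (simp flip: mult.assoc)
qed

lemma tau_nz: "tau \<noteq> 0"
  using tau_square n_gt by (auto simp: gauss_s_def)

section \<open>The two classes of units modulo n\<close>

lemma finite_chi_level [simp, intro]: "finite (chi_level e)"
  by (rule finite_subset[of _ "{..<n}"]) (auto simp: chi_level_def)

lemma chi_level_disjoint: "chi_level 1 \<inter> chi_level (- 1) = {}"
  by (auto simp: chi_level_def)

text \<open>The index ranges differ, \<open>{1..n}\<close> in \<open>cyclotomic\<close> and the
  numbers below n in \<open>chi_level\<close>, but neither 0 nor n is coprime to n.\<close>

lemma chi_level_Un: "chi_level 1 \<union> chi_level (- 1) = {k \<in> {1..n}. coprime k n}"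
proof (rule Set.set_eqI)
  fix k
  show "k \<in> chi_level 1 \<union> chi_level (- 1) \<longleftrightarrow> k \<in> {k \<in> {1..n}. coprime k n}"
    using chi_cases[of k] chi_eq_0_iff[of k] n_gt
    by (cases "k = 0"; cases "k = n") (auto simp: chi_level_def)
qed

lemma sum_chi: "(\<Sum>k<n. chi k * F k) = sum F (chi_level 1) - sum F (chi_level (- 1))"
proof -
  have "(\<Sum>k<n. chi k * F k) = (\<Sum>k\<in>chi_level 1 \<union> chi_level (- 1). chi k * F k)"
    using chi_cases by (intro sum.mono_neutral_right) (auto simp: chi_level_def)
  also have "\<dots> = (\<Sum>k\<in>chi_level 1. chi k * F k) + (\<Sum>k\<in>chi_level (- 1). chi k * F k)"
    by (intro sum.union_disjoint) (use chi_level_disjoint in auto)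
  also have "\<dots> = sum F (chi_level 1) - sum F (chi_level (- 1))"
    by (simp add: chi_level_def sum_negf)
  finally show ?thesis .
qed

text \<open>\<open>gauss_sum 0\<close> counts the difference of the two classes; by separability it
  is \<open>chi 0 * tau\<close>, which is 0.\<close>

lemma card_chi_level: "card (chi_level (- 1)) = card (chi_level 1)"
proof -
  have "gauss_sum 0 = of_nat (card (chi_level 1)) - of_nat (card (chi_level (- 1)))"
    using sum_chi[of "\<lambda>_. 1"] by (simp add: gauss_sum_def)
  then show ?thesis using gauss_sum_separable[of 0] by simp
qed

lemma tau_eq: "tau = (\<Sum>k\<in>chi_level 1. zeta ^ k) - (\<Sum>k\<in>chi_level (- 1). zeta ^ k)"
  unfolding tau_def gauss_sum_def using sum_chi by simp

lemma totient_eq: "totient n = 2 * card (chi_level 1)"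
proof -
  have "totient n = card (chi_level 1 \<union> chi_level (- 1))"
    unfolding chi_level_Un totient_def totatives_def by (intro arg_cong[where f = card]) auto
  also have "\<dots> = card (chi_level 1) + card (chi_level (- 1))"
    by (intro card_Un_disjoint) (use chi_level_disjoint in auto)
  finally show ?thesis by (simp add: card_chi_level)
qed

lemma card_chi_level_pos: "card (chi_level 1) > 0"
  using totient_eq totient_gt_0_iff[of n] n_gt by simp

lemma inj_zeta_power: "inj_on (\<lambda>k. zeta ^ k) {..<n}"
  by (rule inj_onI) (simp add: zeta_power_eq_iff cong_def)

text \<open>The cardinality is half the totient. A composite n splits into two coprime odd factors
  greater than 2, whose totients are both even, so 4 divides the totient of n. This parity decides
  the sign \<open>eps\<close>.\<close>

lemma odd_card_chi_level_iff: "odd (card (chi_level 1)) \<longleftrightarrow> prime n \<and> n mod 4 = 3"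
proof (cases "prime n")
  case True
  then have "2 * card (chi_level 1) = n - 1" using totient_eq totient_prime by simp
  then show ?thesis using True n_odd n_gt by presburger
next
  case False
  obtain p where p: "prime p" "p dvd n" using n_gt prime_factor_nat[of n] by auto
  then obtain m where m: "n = p * m" by blast
  have "coprime p m"
  proof (rule prime_imp_coprime[OF p(1)], rule notI)
    assume "p dvd m"
    then have "p ^ 2 dvd n" by (simp add: m power2_eq_square)
    then show False using n_squarefree p by (metis squarefree_def not_prime_unit)
  qed
  then have t: "totient n = totient p * totient m" unfolding m by (rule totient_mult_coprime)
  have "odd p" "odd m" using n_odd m by auto
  moreover have "m \<noteq> 1" using False p m by auto
  moreover have "m \<noteq> 0" using m n_gt by (cases m) auto
  ultimately have "2 < p \<and> 2 < m" using prime_gt_1_nat[OF p(1)] by presburger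
  then have "even (totient p)" "even (totient m)" by (simp_all add: totient_even)
  then have "4 dvd totient n" unfolding t by (auto elim!: evenE)
  then have "even (card (chi_level 1))" unfolding totient_eq by presburger
  then show ?thesis using False by simp
qed

end

section \<open>The factors in Gauss's identity\<close>

lemma degree_prod_linear:
  fixes c :: "'a \<Rightarrow> complex"
  shows "degree (\<Prod>k\<in>S. [:- c k, 1:]) = card S" "lead_coeff (\<Prod>k\<in>S. [:- c k, 1:]) = 1"
proof -
  show "degree (\<Prod>k\<in>S. [:- c k, 1:]) = card S" by (simp add: degree_prod_sum_eq)
  show "lead_coeff (\<Prod>k\<in>S. [:- c k, 1:]) = 1" unfolding lead_coeff_prod by simp
qed

lemma smult_left_cancel:
  fixes p q :: "complex poly"
  assumes "Polynomial.smult c p = Polynomial.smult c q" "c \<noteq> 0"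
  shows "p = q"
  using arg_cong[OF assms(1), of "Polynomial.smult (1 / c)"] assms(2) by simp

text \<open>Vieta's formula. For empty \<open>S\<close> the truncated \<open>card S - 1\<close>
  would hit the leading coefficient.\<close>

lemma coeff_prod_linear:
  fixes c :: "'a \<Rightarrow> complex"
  assumes "finite S" "S \<noteq> {}"
  shows "poly.coeff (\<Prod>k\<in>S. [:- c k, 1:]) (card S - 1) = - sum c S"
  using assms
proof (induction rule: finite_ne_induct)
  case (insert x S)
  let ?q = "\<Prod>k\<in>S. [:- c k, 1:]"
  have "card S > 0" using insert by (simp add: card_gt_0_iff)
  then obtain m where m: "card S = Suc m" by (cases "card S") auto
  have "poly.coeff ?q (Suc m) = 1" using degree_prod_linear[of c S] m by simp
  moreover have "poly.coeff ?q m = - sum c S" using insert.IH m by simp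
  ultimately show ?case using insert.hyps m by simp
qed simp

text \<open>Both sides have degree at most \<open>card S\<close>, agree in the coefficient of that
  degree, and vanish at the same \<open>card S\<close> distinct points.\<close>

lemma eq_smult_prod_linear:
  fixes c :: "'a \<Rightarrow> complex"
  assumes "finite S" "inj_on c S" "degree p \<le> card S" "\<And>k. k \<in> S \<Longrightarrow> poly p (c k) = 0"
  shows "p = Polynomial.smult (poly.coeff p (card S)) (\<Prod>k\<in>S. [:- c k, 1:])"
proof (rule poly_eqI_degree_lead_coeff[where A = "c ` S" and n = "card S"])
  show "degree (Polynomial.smult (poly.coeff p (card S)) (\<Prod>k\<in>S. [:- c k, 1:])) \<le> card S"
    using degree_smult_le degree_prod_linear(1)[of c S] by metis
  show "poly.coeff p (card S) = poly.coeff (Polynomial.smult (poly.coeff p (card S)) (\<Prod>k\<in>S. [:- c k, 1:])) (card S)"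
    using degree_prod_linear[of c S] by simp
  show "poly p z = poly (Polynomial.smult (poly.coeff p (card S)) (\<Prod>k\<in>S. [:- c k, 1:])) z" if "z \<in> c ` S" for z
    using that assms by (auto simp: poly_prod)
qed (use assms in \<open>auto simp: card_image\<close>)

context odd_squarefree
begin

text \<open>For e = 1 and e = -1 these are the factors \<open>F\<^sub>+\<close> and
  \<open>F\<^sub>-\<close>.\<close>

definition root_prod :: "complex \<Rightarrow> complex poly" where
  "root_prod e = (\<Prod>k\<in>chi_level e. [:- (zeta ^ k), 1:])"

lemma cyclotomic_eq: "cyclotomic n = root_prod 1 * root_prod (- 1)"
proof -
  have "cyclotomic n = (\<Prod>k\<in>chi_level 1 \<union> chi_level (- 1). [:- (zeta ^ k), 1:])"
    unfolding cyclotomic_def chi_level_Un by (simp add: zeta_power)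
  also have "\<dots> = root_prod 1 * root_prod (- 1)"
    unfolding root_prod_def by (rule prod.union_disjoint) (use chi_level_disjoint in auto)
  finally show ?thesis .
qed

lemma degree_root_prod:
  assumes "e \<in> {1, - 1}"
  shows "degree (root_prod e) = card (chi_level 1)" "lead_coeff (root_prod e) = 1"
  using degree_prod_linear[of "\<lambda>k. zeta ^ k" "chi_level e"] card_chi_level assms
  by (auto simp: root_prod_def)

lemma degree_cyclotomic: "degree (cyclotomic n) = 2 * card (chi_level 1)" "lead_coeff (cyclotomic n) = 1"
proof -
  have "root_prod 1 \<noteq> 0" "root_prod (- 1) \<noteq> 0"
    using degree_root_prod[of 1] degree_root_prod[of "- 1"] by auto
  then show "degree (cyclotomic n) = 2 * card (chi_level 1)"
    using degree_root_prod[of 1] degree_root_prod[of "- 1"]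
    by (simp add: cyclotomic_eq degree_mult_eq)
  show "lead_coeff (cyclotomic n) = 1"
    unfolding cyclotomic_eq lead_coeff_mult using degree_root_prod[of 1] degree_root_prod[of "- 1"] by simp
qed

text \<open>This is the effect of the automorphism taking \<open>zeta\<close> to
  \<open>zeta ^ k\<close>: it sends \<open>tau\<close> to \<open>chi k * tau\<close>.\<close>

lemma galois_conjugate:
  fixes A B :: "int poly" and e :: int
  assumes "poly (map_poly of_int A) zeta + of_int e * tau * poly (map_poly of_int B) zeta = 0"
    and "coprime k n"
  shows "poly (map_poly of_int A) (zeta ^ k) + of_int e * chi k * tau * poly (map_poly of_int B) (zeta ^ k) = 0"
proof -
  \<comment> \<open>Since \<open>tau\<close> is the value of the integer polynomial \<open>T\<close>
    at \<open>zeta\<close>, the relation says that an integer polynomial vanishes at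
    \<open>zeta\<close>, and so it carries over to \<open>zeta ^ k\<close>.\<close>
  define T :: "int poly" where "T = (\<Sum>i<n. Polynomial.monom (jacobi (int i) n) i)"
  have "map_poly of_int T = (\<Sum>i<n. Polynomial.monom (chi i) i)"
    by (rule poly_eqI) (simp add: T_def coeff_map_poly coeff_sum coeff_monom chi_def if_distrib)
  then have T: "poly (map_poly of_int T) (zeta ^ j) = chi j * tau" for j
    unfolding gauss_sum_separable[symmetric] gauss_sum_def
    by (simp add: poly_sum poly_monom power_mult)
  have "poly (map_poly of_int (A + Polynomial.smult e (T * B))) zeta = 0"
    using assms T[of 1] by (simp add: map_poly_of_int_simps mult.assoc)
  then have "poly (map_poly of_int (A + Polynomial.smult e (T * B))) (zeta ^ k) = 0"
    using int_poly_root_of_unity_power[of n zeta k] assms n_gt zeta_power_n by simp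
  then show ?thesis by (simp add: map_poly_of_int_simps T mult.assoc)
qed

context
  fixes A B :: "int poly" and a b :: "complex poly"
  assumes gp: "gauss_pair n A B"
  defines "a \<equiv> map_poly of_int A" and "b \<equiv> map_poly of_int B"
begin

lemma gauss_identity:
  "Polynomial.smult 4 (cyclotomic n) = a\<^sup>2 - Polynomial.smult (tau\<^sup>2) (b\<^sup>2)"
  using gp unfolding gauss_pair_def a_def b_def tau_square by blast

lemma gauss_identity_factored:
  "Polynomial.smult 4 (cyclotomic n) = (a + Polynomial.smult tau b) * (a - Polynomial.smult tau b)"
  unfolding gauss_identity by (simp add: algebra_simps power2_eq_square)

lemma lead_coeff_gauss_pair: "lead_coeff a = 2" "lead_coeff b = 1" "degree a = degree A" "degree b = degree B"
proof -
  show *: "degree a = degree A" "degree b = degree B" unfolding a_def b_def by (simp_all add: degree_map_poly)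
  show "lead_coeff a = 2" "lead_coeff b = 1"
    using gp * by (simp_all add: gauss_pair_def a_def b_def coeff_map_poly)
qed

text \<open>Let D = s n. If b had at least the degree of a, the leading coefficient 4 in Gauss's
  identity would equal \<open>- D\<close> or \<open>4 - D\<close>. Both are impossible because D is
  odd, and so is the cancellation that D = 4 would cause.\<close>

lemma degree_gauss_pair: "degree a = card (chi_level 1)" "degree b < card (chi_level 1)"
proof -
  define D where "D = gauss_s n * int n"
  have D: "tau\<^sup>2 = of_int D" "D \<noteq> - 4" "D \<noteq> 0"
    using tau_square n_odd n_gt by (auto simp: D_def gauss_s_def minus_one_power_iff)
  have nz: "a \<noteq> 0" "b \<noteq> 0" using lead_coeff_gauss_pair by auto
  have deg: "degree (a\<^sup>2) = 2 * degree a" "degree (Polynomial.smult (of_int D) (b\<^sup>2)) = 2 * degree b"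
    using D by (simp_all add: degree_power_eq nz)
  have lc: "poly.coeff (a\<^sup>2) (2 * degree a) = 4"
       "poly.coeff (Polynomial.smult (of_int D) (b\<^sup>2)) (2 * degree b) = of_int D"
    using lead_coeff_power[of a 2] lead_coeff_power[of b 2] lead_coeff_gauss_pair nz
    by (simp_all add: degree_power_eq)
  have eq: "Polynomial.smult 4 (cyclotomic n) = a\<^sup>2 - Polynomial.smult (of_int D) (b\<^sup>2)"
    using gauss_identity D by simp
  have degc: "degree (a\<^sup>2 - Polynomial.smult (of_int D) (b\<^sup>2)) = 2 * card (chi_level 1)"
    and lcc: "lead_coeff (a\<^sup>2 - Polynomial.smult (of_int D) (b\<^sup>2)) = 4"
    using degree_cyclotomic by (simp_all flip: eq)
  have "degree b < degree a"
  proof (rule ccontr)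
    assume "\<not> degree b < degree a"
    then consider "degree a < degree b" | "degree a = degree b" by linarith
    then show False
    proof cases
      case 1
      then have "poly.coeff (a\<^sup>2 - Polynomial.smult (of_int D) (b\<^sup>2)) (2 * degree b) = - of_int D"
        using lc deg by (simp add: coeff_eq_0)
      moreover have "degree (a\<^sup>2 - Polynomial.smult (of_int D) (b\<^sup>2)) = 2 * degree b"
        using degree_add_eq_right[of "a\<^sup>2" "- Polynomial.smult (of_int D) (b\<^sup>2)"] 1 deg by simp
      ultimately have "- of_int D = (4 :: complex)" using lcc by simp
      then have "of_int (- D) = (of_int 4 :: complex)" by simp
      then have "- D = 4" by (simp only: of_int_eq_iff)
      then show False using D by simp
    next
      case 2
      then have c: "poly.coeff (a\<^sup>2 - Polynomial.smult (of_int D) (b\<^sup>2)) (2 * degree b) = 4 - of_int D"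
        using lc by simp
      moreover have "4 - of_int D \<noteq> (0 :: complex)"
      proof
        assume "4 - of_int D = (0 :: complex)"
        then have "of_int D = (of_int 4 :: complex)" by simp
        then have "D = 4" by (simp only: of_int_eq_iff)
        then show False using n_odd by (auto simp: D_def gauss_s_def minus_one_power_iff split: if_splits)
      qed
      moreover have "degree (a\<^sup>2 - Polynomial.smult (of_int D) (b\<^sup>2)) \<le> 2 * degree b"
        using 2 deg by (intro degree_diff_le) auto
      ultimately have "degree (a\<^sup>2 - Polynomial.smult (of_int D) (b\<^sup>2)) = 2 * degree b"
        using le_degree[of "a\<^sup>2 - Polynomial.smult (of_int D) (b\<^sup>2)" "2 * degree b"] by simp
      then have "4 - of_int D = (4 :: complex)" using c lcc by metis
      then show False using D by simp
    qed
  qed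
  moreover from this have "degree (a\<^sup>2 - Polynomial.smult (of_int D) (b\<^sup>2)) = 2 * degree a"
    using degree_add_eq_left[of "- Polynomial.smult (of_int D) (b\<^sup>2)" "a\<^sup>2"] deg by simp
  ultimately show "degree a = card (chi_level 1)" "degree b < card (chi_level 1)" using degc by simp_all
qed

text \<open>\<open>e\<close> tells which of the two factors vanishes at \<open>zeta\<close>.
  Conjugation yields zeros at all \<open>zeta ^ k\<close> with \<open>chi k = d\<close>; these are
  as many as the degree allows, and the leading coefficient 2 fixes the scalar.\<close>

lemma gauss_factor:
  fixes e :: int
  assumes e: "e \<in> {1, - 1}" and z: "poly a zeta + of_int e * tau * poly b zeta = 0" and d: "d \<in> {1, - 1}"
  shows "a + Polynomial.smult (d * of_int e * tau) b = Polynomial.smult 2 (root_prod d)"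
proof -
  let ?p = "a + Polynomial.smult (d * of_int e * tau) b"
  let ?m = "card (chi_level 1)"
  have cardd: "card (chi_level d) = ?m" using d card_chi_level by auto
  have lt: "degree (Polynomial.smult (d * of_int e * tau) b) < ?m"
    using degree_gauss_pair(2) degree_smult_le le_less_trans by blast
  have "degree ?p \<le> ?m" using lt degree_gauss_pair(1) by (intro degree_add_le) auto
  moreover have "poly ?p (zeta ^ k) = 0" if "k \<in> chi_level d" for k
  proof -
    have "chi k = d" using that by (simp add: chi_level_def)
    moreover from this have "coprime k n" using d chi_eq_0_iff[of k] by auto
    ultimately show ?thesis
      using galois_conjugate[of A e B k] z unfolding a_def b_def by (simp add: mult_ac)
  qed
  moreover have "inj_on (\<lambda>k. zeta ^ k) (chi_level d)"
    using inj_zeta_power by (rule inj_on_subset) (auto simp: chi_level_def)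
  ultimately have "?p = Polynomial.smult (poly.coeff ?p (card (chi_level d))) (\<Prod>k\<in>chi_level d. [:- (zeta ^ k), 1:])"
    by (intro eq_smult_prod_linear) (use cardd in auto)
  moreover have "poly.coeff ?p (card (chi_level d)) = 2"
    using cardd coeff_eq_0[OF lt] lead_coeff_gauss_pair(1) degree_gauss_pair(1) by simp
  ultimately show ?thesis unfolding root_prod_def by metis
qed

text \<open>The sign is decided by the second coefficients: the root sums of the two factors differ
  by \<open>tau\<close>.\<close>

theorem gauss_pair_eq:
  shows "a = root_prod 1 + root_prod (- 1)" "Polynomial.smult tau b = root_prod (- 1) - root_prod 1"
proof -
  let ?m = "card (chi_level 1)"
  have "1 \<in> chi_level 1" using n_gt by (simp add: chi_level_def)
  then have "poly (root_prod 1) zeta = 0"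
    unfolding root_prod_def poly_prod by (intro prod_zero) (auto intro!: bexI[of _ 1])
  then have "poly (Polynomial.smult 4 (cyclotomic n)) zeta = 0" by (simp add: cyclotomic_eq)
  \<comment> \<open>One of the two factors vanishes at \<open>zeta\<close>, which one being the sign
    \<open>e\<close> that remains to be found.\<close>
  then have "(poly a zeta + tau * poly b zeta) * (poly a zeta - tau * poly b zeta) = 0"
    unfolding gauss_identity_factored by simp
  then obtain e :: int where e: "e \<in> {1, - 1}" "poly a zeta + of_int e * tau * poly b zeta = 0"
    by (auto intro: that[of 1] that[of "-1"])
  note f1 = gauss_factor[OF e, of 1, simplified] and f2 = gauss_factor[OF e, of "- 1", simplified]
  have two: "Polynomial.smult 2 p = p + p" for p :: "complex poly"
    by (metis one_add_one smult_1_left smult_add_left)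
  have "Polynomial.smult 2 (root_prod 1 + root_prod (- 1)) = Polynomial.smult 2 a"
    unfolding smult_add_right f1[symmetric] f2[symmetric] by (simp add: two)
  then show "a = root_prod 1 + root_prod (- 1)" by (rule smult_left_cancel[symmetric]) simp
  have "Polynomial.smult 2 (root_prod 1 - root_prod (- 1)) = Polynomial.smult 2 (Polynomial.smult (of_int e * tau) b)"
    unfolding smult_diff_right two[of "Polynomial.smult (of_int e * tau) b"]
    by (simp flip: f1 f2)
  then have b: "Polynomial.smult (of_int e * tau) b = root_prod 1 - root_prod (- 1)"
    by (rule smult_left_cancel[symmetric]) simp
  have ne: "chi_level 1 \<noteq> {}" "chi_level (- 1) \<noteq> {}"
    using card_chi_level_pos card_chi_level by auto
  \<comment> \<open>The second coefficients of the two products are minus their root sums, so their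
    difference is \<open>- tau\<close>.\<close>
  have "of_int e * tau * poly.coeff b (?m - 1) = - tau"
    using arg_cong[OF b, of "\<lambda>p. poly.coeff p (?m - 1)"]
      coeff_prod_linear[OF finite_chi_level ne(1), of "\<lambda>k. zeta ^ k"]
      coeff_prod_linear[OF finite_chi_level ne(2), of "\<lambda>k. zeta ^ k"] card_chi_level
    by (simp add: root_prod_def tau_eq)
  then have "tau * (of_int e * poly.coeff b (?m - 1)) = tau * (- 1)" by (simp add: mult_ac)
  then have c: "of_int e * poly.coeff b (?m - 1) = - 1" using mult_left_cancel[OF tau_nz] by blast
  then have "poly.coeff b (?m - 1) \<noteq> 0" by auto
  \<comment> \<open>So far the degree of \<open>b\<close> was only bounded. The nonzero coefficient
    attains the bound, hence is the leading coefficient 1, and \<open>e\<close> must be -1.\<close>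
  then have "degree b = ?m - 1" using degree_gauss_pair(2) le_degree[of b "?m - 1"] by linarith
  then have "of_int e = (- 1 :: complex)" using c lead_coeff_gauss_pair(2) by simp
  then show "Polynomial.smult tau b = root_prod (- 1) - root_prod 1"
    using b by (metis minus_diff_eq minus_mult_left minus_minus mult_1 smult_minus_left)
qed

end

end

section \<open>Reciprocal products and the series\<close>

context odd_squarefree
begin

text \<open>For e = 1 and e = -1 these are \<open>R\<^sub>+\<close> and \<open>R\<^sub>-\<close>.
  Their factors are 1 at 0, as the logarithms in the series require.\<close>

definition recip_prod :: "complex \<Rightarrow> complex poly" where
  "recip_prod e = (\<Prod>k\<in>chi_level e. [:1, - (zeta ^ k):])"

definition eps :: complex where "eps = (- 1) ^ card (chi_level 1)"

lemma poly_recip_prod: "poly (recip_prod e) x = (\<Prod>k\<in>chi_level e. 1 - zeta ^ k * x)"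
  by (simp add: recip_prod_def poly_prod mult.commute)

lemma poly_root_prod: "poly (root_prod e) x = (\<Prod>k\<in>chi_level e. x - zeta ^ k)"
  by (simp add: root_prod_def poly_prod)

lemma poly_recip_prod_0 [simp]: "poly (recip_prod e) 0 = 1"
  by (simp add: poly_recip_prod)

lemma card_chi_level_pm: "e \<in> {1, - 1} \<Longrightarrow> card (chi_level e) = card (chi_level 1)"
  using card_chi_level by auto

lemma poly_root_prod_reflect:
  assumes "e \<in> {1, - 1}" "x \<noteq> 0"
  shows "poly (root_prod e) x = x ^ card (chi_level 1) * poly (recip_prod e) (1 / x)"
proof -
  have "poly (root_prod e) x = (\<Prod>k\<in>chi_level e. x * (1 - zeta ^ k * (1 / x)))"
    using assms(2) by (simp add: poly_root_prod algebra_simps)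
  also have "\<dots> = x ^ card (chi_level 1) * poly (recip_prod e) (1 / x)"
    using card_chi_level_pm[OF assms(1)] by (simp only: prod.distrib prod_constant poly_recip_prod)
  finally show ?thesis .
qed

lemma eps_cases: "eps = (if prime n \<and> n mod 4 = 3 then - 1 else 1)"
  unfolding eps_def minus_one_power_iff using odd_card_chi_level_iff by auto

lemma eps_square [simp]: "eps * eps = 1"
  by (simp add: eps_cases)

lemma gauss_s_cases: "gauss_s n = (if n mod 4 = 1 then 1 else - 1)" "n mod 4 = 1 \<or> n mod 4 = 3"
proof -
  show *: "n mod 4 = 1 \<or> n mod 4 = 3" using n_odd by presburger
  have "even ((n - 1) div 2) \<longleftrightarrow> n mod 4 = 1" using n_odd by presburger
  then show "gauss_s n = (if n mod 4 = 1 then 1 else - 1)"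
    by (simp add: gauss_s_def)
qed

text \<open>Negation of k conjugates \<open>zeta ^ k\<close> and multiplies \<open>chi\<close> by s,
  so it preserves the classes for s = 1 and exchanges them for s = -1.\<close>

lemma bij_betw_chi_level_minus:
  assumes "e \<in> {1, - 1}"
  shows "bij_betw (\<lambda>k. n - k) (chi_level e) (chi_level (of_int (gauss_s n) * e))"
proof (rule bij_betw_byWitness[where f' = "\<lambda>k. n - k"])
  have nz: "0 < k" if "k \<in> chi_level e" "e \<noteq> 0" for k e
    using that by (cases "k = 0") (auto simp: chi_level_def)
  have s: "(of_int (gauss_s n) :: complex) * of_int (gauss_s n) = 1" "of_int (gauss_s n) \<noteq> (0 :: complex)"
    using gauss_s_cases by auto
  show "\<forall>k\<in>chi_level e. n - (n - k) = k" "\<forall>k\<in>chi_level (of_int (gauss_s n) * e). n - (n - k) = k"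
    by (auto simp: chi_level_def)
  show "(\<lambda>k. n - k) ` chi_level e \<subseteq> chi_level (of_int (gauss_s n) * e)"
    using nz[of _ e] assms chi_minus by (fastforce simp: chi_level_def)
  show "(\<lambda>k. n - k) ` chi_level (of_int (gauss_s n) * e) \<subseteq> chi_level e"
  proof safe
    fix k assume k: "k \<in> chi_level (of_int (gauss_s n) * e)"
    then have "0 < k" using nz s assms by auto
    then show "n - k \<in> chi_level e"
      using k chi_minus[of k] s n_gt by (simp add: chi_level_def flip: mult.assoc)
  qed
qed

text \<open>For e = 1 and e = -1 this is, up to the sign \<open>eps\<close>, the constant term of
  \<open>root_prod e\<close>.\<close>

definition omega :: "complex \<Rightarrow> complex" where "omega e = (\<Prod>k\<in>chi_level e. zeta ^ k)"

text \<open>Each factor is \<open>- (zeta ^ k) * (1 - zeta ^ (n - k) * x)\<close>, and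
  \<open>n - k\<close> runs through the class of s e.\<close>

lemma poly_root_prod_omega:
  assumes "e \<in> {1, - 1}"
  shows "poly (root_prod e) x = eps * omega e * poly (recip_prod (of_int (gauss_s n) * e)) x"
proof -
  have "zeta ^ k * zeta ^ (n - k) = 1" if "k \<in> chi_level e" for k
    using that zeta_power_n by (simp add: chi_level_def flip: power_add)
  then have "poly (root_prod e) x = (\<Prod>k\<in>chi_level e. - 1 * zeta ^ k * (1 - zeta ^ (n - k) * x))"
    unfolding poly_root_prod by (intro prod.cong refl) (simp add: algebra_simps flip: mult.assoc)
  also have "\<dots> = eps * omega e * (\<Prod>k\<in>chi_level e. 1 - zeta ^ (n - k) * x)"
    by (simp only: prod.distrib prod_constant omega_def eps_def card_chi_level_pm[OF assms])
  also have "(\<Prod>k\<in>chi_level e. 1 - zeta ^ (n - k) * x) = poly (recip_prod (of_int (gauss_s n) * e)) x"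
    unfolding poly_recip_prod
    using prod.reindex_bij_betw[OF bij_betw_chi_level_minus[OF assms], of "\<lambda>k. 1 - zeta ^ k * x"] .
  finally show ?thesis .
qed

lemma omega_mult:
  assumes "e \<in> {1, - 1}"
  shows "omega e * omega (of_int (gauss_s n) * e) = 1"
proof -
  have "omega (of_int (gauss_s n) * e) = (\<Prod>k\<in>chi_level e. zeta ^ (n - k))"
    unfolding omega_def using prod.reindex_bij_betw[OF bij_betw_chi_level_minus[OF assms], of "\<lambda>k. zeta ^ k"] by simp
  then have "omega e * omega (of_int (gauss_s n) * e) = (\<Prod>k\<in>chi_level e. zeta ^ k * zeta ^ (n - k))"
    by (simp add: omega_def prod.distrib)
  also have "\<dots> = 1"
    by (rule prod.neutral) (use zeta_power_n in \<open>simp add: chi_level_def flip: power_add\<close>)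
  finally show ?thesis .
qed

lemma omega_power_n: "omega e ^ n = 1"
  unfolding omega_def prod_power_distrib
  by (rule prod.neutral) (metis mult.commute power_mult power_one zeta_power_n)

text \<open>\<open>omega e\<close> is an n-th root of unity, and -1 is none because n is
  odd.\<close>

lemma omega_eq_1_if_square:
  assumes "omega e * omega e = 1"
  shows "omega e = 1"
proof -
  have "omega e = 1 \<or> omega e = - 1" using assms by (metis square_eq_1_iff)
  then show ?thesis using omega_power_n[of e] n_odd by auto
qed

lemma f_series_sums:
  assumes "norm x \<le> 1" "poly (recip_prod 1) x \<noteq> 0" "poly (recip_prod (- 1)) x \<noteq> 0"
  defines "l \<equiv> ((\<Sum>k\<in>chi_level (- 1). Ln (1 - zeta ^ k * x)) - (\<Sum>k\<in>chi_level 1. Ln (1 - zeta ^ k * x))) / tau"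
  shows "(\<lambda>j. of_int (jacobi (int (Suc j)) n) * x ^ Suc j / of_nat (Suc j)) sums l"
    and "f_series n x = l"
proof -
  have "(\<lambda>j. chi k * ((zeta ^ k * x) ^ Suc j / of_nat (Suc j))) sums (chi k * (- Ln (1 - zeta ^ k * x)))"
    if "k < n" for k
  \<comment> \<open>If \<open>chi k = 0\<close>, the term vanishes even where
    \<open>zeta ^ k * x = 1\<close> and the logarithmic series diverges.\<close>
  proof (cases "chi k = 0")
    case False
    then have "k \<in> chi_level 1 \<or> k \<in> chi_level (- 1)"
      using that chi_cases[of k] by (auto simp: chi_level_def)
    then have "zeta ^ k * x \<noteq> 1" using assms by (auto simp: poly_recip_prod)
    moreover have "norm (zeta ^ k * x) \<le> 1" using assms by (simp add: norm_mult)
    ultimately show ?thesis by (intro sums_mult log_series_sums)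
  qed simp
  then have "(\<lambda>j. \<Sum>k<n. chi k * ((zeta ^ k * x) ^ Suc j / of_nat (Suc j))) sums
      (\<Sum>k<n. chi k * (- Ln (1 - zeta ^ k * x)))"
    by (intro sums_sum) auto
  also have "(\<Sum>k<n. chi k * (- Ln (1 - zeta ^ k * x))) = tau * l"
    unfolding sum_chi l_def using tau_nz by (simp add: sum_negf)
  also have "(\<lambda>j. \<Sum>k<n. chi k * ((zeta ^ k * x) ^ Suc j / of_nat (Suc j))) =
      (\<lambda>j. tau * (of_int (jacobi (int (Suc j)) n) * x ^ Suc j / of_nat (Suc j)))"
  proof (rule ext)
    fix j
    have "(\<Sum>k<n. chi k * ((zeta ^ k * x) ^ Suc j / of_nat (Suc j))) =
        (\<Sum>k<n. chi k * zeta ^ (Suc j * k)) * (x ^ Suc j / of_nat (Suc j))"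
      unfolding sum_distrib_right
      by (intro sum.cong refl) (simp only: power_mult_distrib power_mult[symmetric] mult.commute[of "Suc j"] times_divide_eq_right mult.assoc)
    also have "(\<Sum>k<n. chi k * zeta ^ (Suc j * k)) = chi (Suc j) * tau"
      using gauss_sum_separable[of "Suc j"] by (simp only: gauss_sum_def)
    finally show "(\<Sum>k<n. chi k * ((zeta ^ k * x) ^ Suc j / of_nat (Suc j))) =
        tau * (of_int (jacobi (int (Suc j)) n) * x ^ Suc j / of_nat (Suc j))"
      by (simp only: chi_def mult_ac times_divide_eq_right)
  qed
  finally have "(\<lambda>j. tau * (of_int (jacobi (int (Suc j)) n) * x ^ Suc j / of_nat (Suc j))) sums (tau * l)" .
  then show "(\<lambda>j. of_int (jacobi (int (Suc j)) n) * x ^ Suc j / of_nat (Suc j)) sums l"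
    using tau_nz by (subst (asm) sums_mult_iff)
  then show "f_series n x = l" unfolding f_series_def by (rule sums_unique[symmetric])
qed

lemma exp_tau_f_series:
  assumes "norm x \<le> 1" "poly (recip_prod 1) x \<noteq> 0" "poly (recip_prod (- 1)) x \<noteq> 0"
  shows "exp (tau * f_series n x) * poly (recip_prod 1) x = poly (recip_prod (- 1)) x"
proof -
  have e: "exp (\<Sum>k\<in>chi_level e. Ln (1 - zeta ^ k * x)) = poly (recip_prod e) x"
    if "poly (recip_prod e) x \<noteq> 0" for e
    using that by (simp add: exp_sum poly_recip_prod)
  have "tau * f_series n x = (\<Sum>k\<in>chi_level (- 1). Ln (1 - zeta ^ k * x)) - (\<Sum>k\<in>chi_level 1. Ln (1 - zeta ^ k * x))"
    using f_series_sums(2)[OF assms] tau_nz by simp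
  then have "exp (tau * f_series n x) = poly (recip_prod (- 1)) x / poly (recip_prod 1) x"
    using e assms by (simp add: exp_diff)
  then show ?thesis using assms by simp
qed

lemma continuous_on_f_series:
  "continuous_on {x. norm x \<le> 1 \<and> poly (recip_prod 1) x \<noteq> 0 \<and> poly (recip_prod (- 1)) x \<noteq> 0} (f_series n)"
  (is "continuous_on ?S _")
proof -
  have c: "continuous_on ?S (\<lambda>x. \<Sum>k\<in>chi_level e. Ln (1 - zeta ^ k * x))" if "e \<in> {1, - 1}" for e
  proof (intro continuous_on_sum continuous_on_Ln continuous_intros)
    fix k assume k: "k \<in> chi_level e"
    show "1 - zeta ^ k * x \<notin> \<real>\<^sub>\<le>\<^sub>0" if x: "x \<in> ?S" for x
    proof -
      have "zeta ^ k * x \<noteq> 1" using k x \<open>e \<in> {1, - 1}\<close> by (auto simp: poly_recip_prod)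
      moreover have "norm (zeta ^ k * x) \<le> 1" using x by (simp add: norm_mult)
      ultimately show ?thesis using Re_one_minus_pos[of "zeta ^ k * x"] by (auto simp: complex_nonpos_Reals_iff)
    qed
  qed
  have "continuous_on ?S (\<lambda>x. ((\<Sum>k\<in>chi_level (- 1). Ln (1 - zeta ^ k * x)) - (\<Sum>k\<in>chi_level 1. Ln (1 - zeta ^ k * x))) / tau)"
    using tau_nz by (intro continuous_intros c) auto
  then show ?thesis
    by (rule continuous_on_eq) (use f_series_sums(2) in auto)
qed

lemma recip_prod_nonzero:
  assumes "norm x < 1"
  shows "poly (recip_prod e) x \<noteq> 0"
proof
  assume "poly (recip_prod e) x = 0"
  then obtain k where "1 - zeta ^ k * x = 0" by (auto simp: poly_recip_prod)
  then have "norm (zeta ^ k * x) = 1" by simp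
  then show False using assms by (simp add: norm_mult)
qed

lemma f_series_has_fps_expansion: "f_series n has_fps_expansion f_fps n"
proof (rule has_fps_expansionI)
  have "(\<lambda>j. fps_nth (f_fps n) j * u ^ j) sums f_series n u" if "norm u < 1" for u
  proof -
    have "(\<lambda>j. of_int (jacobi (int (Suc j)) n) * u ^ Suc j / of_nat (Suc j)) sums f_series n u"
      using f_series_sums[of u] recip_prod_nonzero[of u] that by simp
    then have "(\<lambda>j. fps_nth (f_fps n) (Suc j) * u ^ Suc j) sums f_series n u"
      by (simp add: f_fps_def del: of_nat_Suc power_Suc)
    then show ?thesis by (subst (asm) sums_Suc_iff) (simp add: f_fps_def)
  qed
  then show "\<forall>\<^sub>F u in nhds 0. (\<lambda>j. fps_nth (f_fps n) j * u ^ j) sums f_series n u"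
    by (intro eventually_nhds_in_open[of "ball 0 1", THEN eventually_mono]) auto
qed

end

section \<open>The closed formulas\<close>

text \<open>The quotient of h and D is continuous with values 1 and -1, hence constant on a
  connected set, and a single point fixes the sign.\<close>

lemma eq_on_connected_if_squares_eq:
  fixes h D :: "'a :: topological_space \<Rightarrow> complex"
  assumes "connected S" "continuous_on S h" "continuous_on S D"
    and sq: "\<And>x. x \<in> S \<Longrightarrow> h x * h x = D x * D x" and nz: "\<And>x. x \<in> S \<Longrightarrow> D x \<noteq> 0"
    and a: "a \<in> S" "h a = D a" and x: "x \<in> S"
  shows "h x = D x"
proof -
  have "continuous_on S (\<lambda>x. h x / D x)" using assms by (intro continuous_intros) auto
  moreover have "h y / D y \<in> {1, - 1}" if "y \<in> S" for y
  proof -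
    have "(h y / D y) * (h y / D y) = 1" using sq[OF that] nz[OF that] by simp
    then show ?thesis using square_eq_1_iff by blast
  qed
  then have "(\<lambda>x. h x / D x) ` S \<subseteq> {1, - 1}" by (rule image_subsetI)
  then have "finite ((\<lambda>x. h x / D x) ` S)" by (rule finite_subset) simp
  ultimately have "(\<lambda>x. h x / D x) constant_on S"
    using continuous_finite_range_constant_eq assms(1) by blast
  then have "h x / D x = h a / D a" using a x unfolding constant_on_def by metis
  then show ?thesis using a nz x by (simp add: field_simps)
qed

text \<open>Here E and F stand for the exponentials of tau f / 2 and tau f, P and M for the values
  of \<open>R\<^sub>+\<close> and \<open>R\<^sub>-\<close>, G for a square root of the cyclotomic
  polynomial, and d for a sign.\<close>

lemma square_mult_eq:
  fixes G E F P M d :: complex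
  assumes "E * E = F" "F * P = M" "G * G = P * M" "d * d = 1"
  shows "G * E * (G * E) = d * M * (d * M)"
proof -
  have "G * E * (G * E) = (G * G) * (E * E)" by simp
  also have "\<dots> = (F * P) * M" unfolding assms(1,3) by simp
  also have "\<dots> = (d * d) * (M * M)" unfolding assms(2,4) by simp
  finally show ?thesis by simp
qed

lemma mult_inverse_pair:
  fixes S N E :: complex
  assumes "N * E = 1"
  shows "S * N * (S * E) = S * S"
proof -
  have "S * N * (S * E) = S * S * (N * E)" by (simp only: mult_ac)
  then show ?thesis using assms by simp
qed

lemma poly_has_fps_expansion: "poly p has_fps_expansion fps_of_poly (p :: complex poly)"
  by (simp add: has_fps_expansion_def)

context odd_squarefree
begin

lemma root_prod_at_0: "e \<in> {1, - 1} \<Longrightarrow> poly (root_prod e) 0 = eps * omega e"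
  using poly_root_prod_omega[of e 0] by simp

text \<open>For s = 1 the square of \<open>omega e\<close> is 1 by \<open>omega_mult\<close>. For s
  = -1 the constant terms of A and B are integers, and Gauss's identity at 0 leaves so few
  possibilities for them that \<open>omega 1 = omega (- 1)\<close>.\<close>

lemma omega_eq_1:
  assumes gp: "gauss_pair n A B" and e: "e \<in> {1, - 1}"
  shows "omega e = 1"
proof (cases "n mod 4 = 1")
  case True
  then show ?thesis using omega_mult[OF e] gauss_s_cases(1) omega_eq_1_if_square by simp
next
  case False
  then have s: "gauss_s n = - 1" using gauss_s_cases by simp
  have w: "omega 1 * omega (- 1) = 1" using omega_mult[of 1] s by simp
  define \<alpha> \<beta> where "\<alpha> = poly.coeff A 0" and "\<beta> = poly.coeff B 0"
  have ev: "poly (map_poly of_int A) 0 = (of_int \<alpha> :: complex)" "poly (map_poly of_int B) 0 = (of_int \<beta> :: complex)"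
    by (simp_all add: \<alpha>_def \<beta>_def poly_0_coeff_0 coeff_map_poly)
  have a: "of_int \<alpha> = eps * (omega 1 + omega (- 1))"
    using arg_cong[OF gauss_pair_eq(1)[OF gp], of "\<lambda>p. poly p 0"]
    by (simp add: ev root_prod_at_0 algebra_simps)
  have b: "tau * of_int \<beta> = eps * (omega (- 1) - omega 1)"
    using arg_cong[OF gauss_pair_eq(2)[OF gp], of "\<lambda>p. poly p 0"]
    by (simp add: ev root_prod_at_0 algebra_simps)
  have "of_int (\<alpha>\<^sup>2 + int n * \<beta>\<^sup>2) = (of_int \<alpha>)\<^sup>2 - (tau * of_int \<beta>)\<^sup>2"
    unfolding power_mult_distrib tau_square s by simp
  also have "\<dots> = (eps * eps) * (4 * (omega 1 * omega (- 1)))"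
    unfolding a b by (simp add: power2_eq_square algebra_simps)
  finally have "of_int (\<alpha>\<^sup>2 + int n * \<beta>\<^sup>2) = (of_int 4 :: complex)" using w by simp
  then have eq: "\<alpha>\<^sup>2 + int n * \<beta>\<^sup>2 = 4" by (simp only: of_int_eq_iff)
  \<comment> \<open>For n = 3 the equation would also allow both constant terms to be 1 or
    -1.\<close>
  have "n > 4" using n_gt n_odd by (cases "n = 4") auto
  have "\<beta> = 0"
  proof (rule ccontr)
    assume "\<beta> \<noteq> 0"
    then have "1 \<le> \<beta>\<^sup>2" by (simp add: int_one_le_iff_zero_less)
    then have "int n * 1 \<le> int n * \<beta>\<^sup>2" by (intro mult_left_mono) auto
    then have "\<alpha>\<^sup>2 < 0" using eq \<open>n > 4\<close> by linarith
    then show False by simp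
  qed
  then have "omega (- 1) = omega 1" using b by (auto simp: eps_cases split: if_splits)
  then show ?thesis using w e omega_eq_1_if_square[of 1] by auto
qed

context
  fixes A B :: "int poly"
  assumes gp: "gauss_pair n A B"
begin

lemma root_prod_eq:
  assumes "e \<in> {1, - 1}"
  shows "root_prod e = Polynomial.smult eps (recip_prod (of_int (gauss_s n) * e))"
proof -
  have "poly (root_prod e) = poly (Polynomial.smult eps (recip_prod (of_int (gauss_s n) * e)))"
    using poly_root_prod_omega[OF assms] omega_eq_1[OF gp assms] by auto
  then show ?thesis by (simp only: poly_eq_poly_eq_iff)
qed

lemma cyclotomic_eq_recip: "cyclotomic n = recip_prod 1 * recip_prod (- 1)"
proof -
  consider "gauss_s n = 1" | "gauss_s n = - 1" using gauss_s_cases(1) by metis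
  then show ?thesis
    using root_prod_eq[of 1] root_prod_eq[of "- 1"] by cases (simp_all add: cyclotomic_eq mult.commute)
qed

lemma eps_if_s: "of_int (gauss_s n) = (1 :: complex) \<Longrightarrow> eps = 1"
  using gauss_s_cases by (auto simp: eps_cases split: if_splits)

lemma gauss_pair_recip:
  shows "map_poly of_int A = Polynomial.smult eps (recip_prod 1 + recip_prod (- 1))"
    and "Polynomial.smult tau (map_poly of_int B) =
      Polynomial.smult (of_int (gauss_s n) * eps) (recip_prod (- 1) - recip_prod 1)"
proof -
  consider "gauss_s n = 1" | "gauss_s n = - 1" using gauss_s_cases(1) by metis
  note c = this
  show "map_poly of_int A = Polynomial.smult eps (recip_prod 1 + recip_prod (- 1))"
    using c gauss_pair_eq(1)[OF gp] root_prod_eq[of 1] root_prod_eq[of "- 1"]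
    by cases (simp_all add: smult_add_right)
  show "Polynomial.smult tau (map_poly of_int B) =
      Polynomial.smult (of_int (gauss_s n) * eps) (recip_prod (- 1) - recip_prod 1)"
    using c gauss_pair_eq(2)[OF gp] root_prod_eq[of 1] root_prod_eq[of "- 1"]
    by cases (simp_all add: smult_diff_right)
qed

section \<open>Values at real points\<close>

lemma recip_prod_nonzero_real:
  assumes "e \<in> {1, - 1}"
  shows "poly (recip_prod e) (of_real t) \<noteq> 0"
proof
  assume "poly (recip_prod e) (of_real t) = 0"
  then obtain k where k: "k \<in> chi_level e" "zeta ^ k * of_real t = 1" by (auto simp: poly_recip_prod)
  have "norm (zeta ^ k * of_real t) = 1" using k by simp
  then have "\<bar>t\<bar> = 1" by (simp add: norm_mult)
  then have "t * t = 1" by (metis abs_mult_self_eq mult_1)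
  \<comment> \<open>Squaring removes the sign of t: a real inverse of \<open>zeta ^ k\<close> forces
    \<open>zeta ^ (k + k) = 1\<close>, so n, being odd, divides k.\<close>
  have "zeta ^ (k + k) * of_real (t * t) = (zeta ^ k * of_real t) * (zeta ^ k * of_real t)"
    by (simp add: power_add)
  then have "zeta ^ (k + k) = 1" using k \<open>t * t = 1\<close> by simp
  then have "n dvd 2 * k" by (simp add: zeta_power_eq_1_iff mult_2)
  then have "n dvd k" using n_odd by (simp add: coprime_dvd_mult_right_iff)
  then have "chi k = 0" using chi_eq_0_iff[of k] n_gt by (metis coprime_absorb_left coprime_commute dvd_refl is_unit_gcd less_numeral_extra(4) nat_dvd_1_iff_1 not_numeral_less_one)
  then show False using k assms by (auto simp: chi_level_def)
qed

lemma cnj_poly_recip_prod: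
  assumes "e \<in> {1, - 1}"
  shows "cnj (poly (recip_prod e) (of_real t)) = poly (recip_prod (of_int (gauss_s n) * e)) (of_real t)"
proof -
  have "cnj (zeta ^ k) = zeta ^ (n - k)" if "k \<in> chi_level e" for k
  proof -
    have "zeta ^ k * zeta ^ (n - k) = 1"
      using that zeta_power_n by (simp add: chi_level_def flip: power_add)
    moreover have "zeta ^ k * cnj (zeta ^ k) = 1"
      by (metis complex_norm_square norm_zeta_power of_real_1 power_one)
    ultimately show ?thesis using zeta_nz by (metis mult_left_cancel power_not_zero)
  qed
  then have "cnj (poly (recip_prod e) (of_real t)) = (\<Prod>k\<in>chi_level e. 1 - zeta ^ (n - k) * of_real t)"
    unfolding poly_recip_prod cnj_prod by (intro prod.cong refl) (simp del: complex_cnj_power)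
  also have "\<dots> = poly (recip_prod (of_int (gauss_s n) * e)) (of_real t)"
    unfolding poly_recip_prod
    using prod.reindex_bij_betw[OF bij_betw_chi_level_minus[OF assms], of "\<lambda>k. 1 - zeta ^ k * of_real t"] .
  finally show ?thesis .
qed

definition Phi :: "real \<Rightarrow> real" where "Phi t = Re (poly (cyclotomic n) (of_real t))"

lemma cyclotomic_of_real: "poly (cyclotomic n) (of_real t) = of_real (Phi t)"
proof -
  have "cnj (poly (cyclotomic n) (of_real t)) = poly (cyclotomic n) (of_real t)"
    using cnj_poly_recip_prod[of 1 t] cnj_poly_recip_prod[of "- 1" t] gauss_s_cases
    by (auto simp: cyclotomic_eq_recip mult.commute split: if_splits)
  then show ?thesis unfolding Phi_def by (metis Reals_cnj_iff of_real_Re)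
qed

text \<open>The value at 0 is 1 and there are no real zeros, so the intermediate value theorem
  applies.\<close>

lemma Phi_pos: "Phi t > 0"
proof (rule ccontr)
  assume "\<not> Phi t > 0"
  moreover have "continuous_on UNIV Phi"
    unfolding Phi_def by (intro continuous_intros)
  then have "connected (range Phi)" by (rule connected_continuous_image) simp
  moreover have "Phi 0 = 1" by (simp add: Phi_def cyclotomic_eq_recip)
  ultimately have "0 \<in> range Phi"
    using connectedD_interval[of "range Phi" "Phi t" "Phi 0" 0] by auto
  then obtain u where "Phi u = 0" by auto
  then have "poly (cyclotomic n) (of_real u) = 0" by (simp add: cyclotomic_of_real)
  then show False using recip_prod_nonzero_real[of 1 u] recip_prod_nonzero_real[of "- 1" u]
    by (simp add: cyclotomic_eq_recip)
qed

lemma cyclotomic_of_real_sqrt: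
  "poly (recip_prod 1) (of_real t) * poly (recip_prod (- 1)) (of_real t) = of_real (sqrt (Phi t)) * of_real (sqrt (Phi t))"
  using cyclotomic_of_real[of t] Phi_pos[of t] by (simp add: cyclotomic_eq_recip flip: of_real_mult)

lemma f_series_0: "f_series n 0 = 0"
  using f_series_sums(2)[of 0] by simp

text \<open>Both sides have the same square by \<open>exp_tau_f_series\<close>, and both are 1 at
  0.\<close>

lemma sqrt_exp_half_inner:
  assumes "\<bar>u\<bar> \<le> 1"
  shows "of_real (sqrt (Phi u)) * exp (tau / 2 * f_series n (of_real u)) = poly (recip_prod (- 1)) (of_real u)"
proof (rule eq_on_connected_if_squares_eq[where S = "{- 1..1 :: real}" and a = 0])
  have "continuous_on {- 1..1 :: real} (\<lambda>u. f_series n (of_real u))"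
    by (rule continuous_on_compose2[OF continuous_on_f_series])
       (auto intro!: continuous_intros simp: recip_prod_nonzero_real abs_le_iff)
  moreover have "continuous_on {- 1..1} Phi" unfolding Phi_def by (intro continuous_intros)
  ultimately show "continuous_on {- 1..1} (\<lambda>u. of_real (sqrt (Phi u)) * exp (tau / 2 * f_series n (of_real u)))"
    by (intro continuous_intros)
  show "of_real (sqrt (Phi v)) * exp (tau / 2 * f_series n (of_real v)) * (of_real (sqrt (Phi v)) * exp (tau / 2 * f_series n (of_real v)))
     = poly (recip_prod (- 1)) (of_real v) * poly (recip_prod (- 1)) (of_real v)" if "v \<in> {- 1..1}" for v
  proof -
    have "exp (tau / 2 * f_series n (of_real v)) * exp (tau / 2 * f_series n (of_real v)) = exp (tau * f_series n (of_real v))"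
      by (simp flip: exp_add)
    moreover have "exp (tau * f_series n (of_real v)) * poly (recip_prod 1) (of_real v) = poly (recip_prod (- 1)) (of_real v)"
      using that by (intro exp_tau_f_series) (auto simp: recip_prod_nonzero_real)
    ultimately show ?thesis using square_mult_eq[where d = 1] cyclotomic_of_real_sqrt[of v] by simp
  qed
  show "of_real (sqrt (Phi 0)) * exp (tau / 2 * f_series n (of_real 0)) = poly (recip_prod (- 1)) (of_real 0)"
    by (simp add: Phi_def cyclotomic_eq_recip f_series_0)
qed (use assms in \<open>auto intro!: continuous_intros simp: recip_prod_nonzero_real\<close>)

lemma sqrt_exp_neg_half_inner:
  assumes "\<bar>u\<bar> \<le> 1"
  shows "of_real (sqrt (Phi u)) * exp (- (tau / 2 * f_series n (of_real u))) = poly (recip_prod 1) (of_real u)"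
proof -
  let ?E = "exp (tau / 2 * f_series n (of_real u))"
  have "exp (- (tau / 2 * f_series n (of_real u))) * ?E = 1" by (simp flip: exp_add)
  then have "of_real (sqrt (Phi u)) * exp (- (tau / 2 * f_series n (of_real u))) * poly (recip_prod (- 1)) (of_real u)
    = poly (recip_prod 1) (of_real u) * poly (recip_prod (- 1)) (of_real u)"
    unfolding cyclotomic_of_real_sqrt unfolding sqrt_exp_half_inner[OF assms, symmetric]
    by (rule mult_inverse_pair)
  then show ?thesis using recip_prod_nonzero_real[of "- 1" u] by simp
qed

text \<open>The point 1 is its own reciprocal, so \<open>F\<^sub>+\<close> and
  \<open>R\<^sub>+\<close> agree there, while \<open>F\<^sub>+\<close> is \<open>eps\<close> times
  \<open>R\<^sub>-\<close>. The value is needed because the continuation of f outside the disc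
  contains 2 f(1).\<close>

lemma exp_tau_f_1:
  assumes "n mod 4 = 3"
  shows "exp (tau * f_series n 1) = eps"
proof -
  have s: "gauss_s n = - 1" using assms gauss_s_cases by simp
  have "poly (recip_prod 1) 1 = poly (root_prod 1) 1" using poly_root_prod_reflect[of 1 1] by simp
  also have "\<dots> = eps * poly (recip_prod (- 1)) 1" using root_prod_eq[of 1] s by simp
  finally have r: "poly (recip_prod 1) 1 = eps * poly (recip_prod (- 1)) 1" .
  have nz: "poly (recip_prod 1) 1 \<noteq> 0" "poly (recip_prod (- 1)) 1 \<noteq> 0"
    using recip_prod_nonzero_real[of _ 1] by auto
  have "exp (tau * f_series n 1) * (eps * poly (recip_prod (- 1)) 1) = poly (recip_prod (- 1)) 1"
    using exp_tau_f_series[of 1] nz r by simp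
  then have "exp (tau * f_series n 1) * eps = 1" using nz by simp
  then have "exp (tau * f_series n 1) * (eps * eps) = eps" by (metis mult.assoc mult_1)
  then show ?thesis by simp
qed

text \<open>Let m be half the degree of the cyclotomic polynomial. Outside the disc the positive
  square root involves \<open>\<bar>t\<bar> ^ m\<close> where the product formulas have
  \<open>t ^ m\<close>; for t < -1 the two differ by \<open>(- 1) ^ m = eps\<close>.\<close>

definition delta :: "real \<Rightarrow> complex" where "delta t = (if t < - 1 then eps else 1)"

lemma sqrt_exp_half:
  "of_real (sqrt (Phi t)) * exp (tau / 2 * f_fun n (of_real t)) = delta t * poly (recip_prod (- 1)) (of_real t)"
proof (cases "\<bar>t\<bar> \<le> 1")
  case True
  then show ?thesis using sqrt_exp_half_inner[OF True] by (simp add: f_fun_def delta_def)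
next
  case False
  let ?m = "card (chi_level 1)"
  define u where "u = 1 / t"
  have t: "t \<noteq> 0" "\<bar>u\<bar> \<le> 1" using False by (auto simp: u_def divide_simps)
  have u: "of_real u = 1 / (of_real t :: complex)" by (simp add: u_def)
  have reflect: "poly (root_prod e) (of_real t) = of_real t ^ ?m * poly (recip_prod e) (of_real u)"
    if "e \<in> {1, - 1}" for e
    using poly_root_prod_reflect[OF that, of "of_real t"] t u by simp
  \<comment> \<open>Reflecting both factors reduces the square root at t to the one at u, which lies
    in the interval already treated.\<close>
  have "complex_of_real (Phi t) = of_real t ^ ?m * of_real t ^ ?m * of_real (Phi u)"
    unfolding cyclotomic_of_real[symmetric]
    by (subst cyclotomic_eq) (simp add: reflect cyclotomic_eq_recip)
  then have "complex_of_real (Phi t) = of_real (t ^ ?m * t ^ ?m * Phi u)" by simp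
  then have "Phi t = t ^ ?m * t ^ ?m * Phi u" by (simp only: of_real_eq_iff)
  then have sq: "sqrt (Phi t) = \<bar>t\<bar> ^ ?m * sqrt (Phi u)"
    by (simp add: real_sqrt_mult power_abs)
  have "(- 1) ^ ?m = eps" by (simp add: eps_def)
  then have abst: "complex_of_real (\<bar>t\<bar> ^ ?m) = delta t * of_real t ^ ?m"
  proof (cases "t < 0")
    case True
    then have "t < - 1" using False by simp
    then show ?thesis using True \<open>(- 1) ^ ?m = eps\<close> by (simp add: delta_def power_minus[of "of_real t"])
  next
    case False
    then show ?thesis by (simp add: delta_def)
  qed
  show ?thesis
  proof (cases "n mod 4 = 1")
    case True
    then have s: "gauss_s n = 1" "eps = 1" using gauss_s_cases eps_if_s by auto
    have "f_fun n (of_real t) = f_series n (of_real u)" using False True u by (simp add: f_fun_def)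
    then have "of_real (sqrt (Phi t)) * exp (tau / 2 * f_fun n (of_real t))
      = complex_of_real (\<bar>t\<bar> ^ ?m) * poly (recip_prod (- 1)) (of_real u)"
      using sqrt_exp_half_inner[OF t(2)] by (simp add: sq mult.assoc)
    also have "\<dots> = delta t * poly (root_prod (- 1)) (of_real t)"
      unfolding abst by (simp add: reflect mult.assoc)
    finally show ?thesis using root_prod_eq[of "- 1"] s by simp
  next
    case False3: False
    then have n3: "n mod 4 = 3" and s: "gauss_s n = - 1" using gauss_s_cases by auto
    have ff: "f_fun n (of_real t) = 2 * f_series n 1 - f_series n (of_real u)"
      using False False3 u by (simp add: f_fun_def)
    \<comment> \<open>Half of the constant \<open>2 * f_series n 1\<close> contributes the factor
      \<open>eps\<close>, and the minus sign replaces \<open>R\<^sub>-\<close> at u by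
      \<open>R\<^sub>+\<close>. The identity between \<open>F\<^sub>+\<close> and \<open>eps\<close>
      times \<open>R\<^sub>-\<close> undoes both.\<close>
    have "exp (tau / 2 * f_fun n (of_real t)) = exp (tau * f_series n 1 + (- (tau / 2 * f_series n (of_real u))))"
      unfolding ff by (simp add: algebra_simps)
    also have "\<dots> = eps * exp (- (tau / 2 * f_series n (of_real u)))"
      unfolding exp_add exp_tau_f_1[OF n3] ..
    finally have "of_real (sqrt (Phi t)) * exp (tau / 2 * f_fun n (of_real t))
      = complex_of_real (\<bar>t\<bar> ^ ?m) * (eps * poly (recip_prod 1) (of_real u))"
      using sqrt_exp_neg_half_inner[OF t(2)] by (simp add: sq mult_ac)
    also have "\<dots> = delta t * eps * poly (root_prod 1) (of_real t)"
      unfolding abst by (simp add: reflect mult_ac)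
    also have "\<dots> = delta t * (eps * eps) * poly (recip_prod (- 1)) (of_real t)"
      using root_prod_eq[of 1] s by (simp add: mult_ac)
    finally show ?thesis by simp
  qed
qed

text \<open>Outside the disc this follows from the identity at \<open>1 / x\<close>. If n is 3
  modulo 4, the classes are exchanged, the exponent changes sign, and the constant contributes
  \<open>eps * eps = 1\<close>.\<close>

lemma exp_tau_f_fun:
  assumes "poly (cyclotomic n) x \<noteq> 0"
  shows "exp (tau * f_fun n x) * poly (recip_prod 1) x = poly (recip_prod (- 1)) x"
proof (cases "norm x \<le> 1")
  case True
  then show ?thesis using exp_tau_f_series[OF True] assms by (simp add: f_fun_def cyclotomic_eq_recip)
next
  case False
  let ?m = "card (chi_level 1)"
  have x: "x \<noteq> 0" "norm (1 / x) < 1" using False by (auto simp: norm_divide divide_simps)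
  have inner: "exp (tau * f_series n (1 / x)) * poly (recip_prod 1) (1 / x) = poly (recip_prod (- 1)) (1 / x)"
    using x recip_prod_nonzero[OF x(2)] by (intro exp_tau_f_series) auto
  have outer: "exp (tau * f_series n (1 / x)) * poly (root_prod 1) x = poly (root_prod (- 1)) x"
    using poly_root_prod_reflect[of 1 x] poly_root_prod_reflect[of "- 1" x] x inner
    by (simp add: mult_ac)
  show ?thesis
  proof (cases "n mod 4 = 1")
    case True
    then have s: "gauss_s n = 1" "eps = 1" using gauss_s_cases eps_if_s by auto
    show ?thesis using outer root_prod_eq[of 1] root_prod_eq[of "- 1"] s True False by (simp add: f_fun_def)
  next
    case False3: False
    then have n3: "n mod 4 = 3" and s: "gauss_s n = - 1" using gauss_s_cases by auto
    have nz: "eps \<noteq> 0" by (auto simp: eps_cases)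
    have "exp (tau * f_series n (1 / x)) * poly (recip_prod (- 1)) x = poly (recip_prod 1) x"
      using outer root_prod_eq[of 1] root_prod_eq[of "- 1"] s nz by simp
    moreover have "exp (tau * f_fun n x) * exp (tau * f_series n (1 / x)) = exp (tau * f_series n 1) * exp (tau * f_series n 1)"
      using False False3 by (simp add: f_fun_def algebra_simps flip: exp_add)
    ultimately show ?thesis using exp_tau_f_1[OF n3] eps_square by (metis mult.assoc mult_1)
  qed
qed

text \<open>On the connected set R both sides of the first formula have the same square, and
  \<open>sqrt_exp_half\<close> fixes the sign at t. The second formula comes from dividing the
  square of g by the first.\<close>

lemma branch_exp:
  assumes "sqrt_branch n R t g" "x \<in> R"
  shows "g x * exp (tau / 2 * f_fun n x) = delta t * poly (recip_prod (- 1)) x"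
    and "g x * exp (- (tau / 2 * f_fun n x)) = delta t * poly (recip_prod 1) x"
proof -
  have R: "connected R" "\<And>x. x \<in> R \<Longrightarrow> poly (cyclotomic n) x \<noteq> 0" "continuous_on R (f_fun n)"
    "continuous_on R g" "\<And>x. x \<in> R \<Longrightarrow> g x * g x = poly (cyclotomic n) x" "of_real t \<in> R"
    "g (of_real t) = of_real (sqrt (Phi t))"
    using assms(1) simply_connected_imp_connected
    by (auto simp: sqrt_branch_def power2_eq_square Phi_def)
  have d: "delta t * delta t = 1" "delta t \<noteq> 0" by (auto simp: delta_def eps_cases)
  have nz: "poly (recip_prod 1) x \<noteq> 0" "poly (recip_prod (- 1)) x \<noteq> 0" if "x \<in> R" for x
    using R(2)[OF that] by (auto simp: cyclotomic_eq_recip)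
  show 1: "g x * exp (tau / 2 * f_fun n x) = delta t * poly (recip_prod (- 1)) x"
  proof (rule eq_on_connected_if_squares_eq[OF R(1), where a = "of_real t" and x = x
      and h = "\<lambda>x. g x * exp (tau / 2 * f_fun n x)" and D = "\<lambda>x. delta t * poly (recip_prod (- 1)) x"])
    show "g y * exp (tau / 2 * f_fun n y) * (g y * exp (tau / 2 * f_fun n y)) =
        delta t * poly (recip_prod (- 1)) y * (delta t * poly (recip_prod (- 1)) y)" if "y \<in> R" for y
    proof -
      have "exp (tau / 2 * f_fun n y) * exp (tau / 2 * f_fun n y) = exp (tau * f_fun n y)"
        by (simp flip: exp_add)
      moreover have "g y * g y = poly (recip_prod 1) y * poly (recip_prod (- 1)) y"
        using R(5)[OF that] by (simp add: cyclotomic_eq_recip)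
      ultimately show ?thesis
        by (rule square_mult_eq[OF _ exp_tau_f_fun[OF R(2)[OF that]] _ d(1)])
    qed
    show "g (of_real t) * exp (tau / 2 * f_fun n (of_real t)) = delta t * poly (recip_prod (- 1)) (of_real t)"
      using sqrt_exp_half R(7) by simp
  qed (use R nz d assms in \<open>auto intro!: continuous_intros\<close>)
  have inv: "exp (- (tau / 2 * f_fun n x)) * exp (tau / 2 * f_fun n x) = 1" by (simp flip: exp_add)
  have "g x * g x = poly (recip_prod 1) x * poly (recip_prod (- 1)) x"
    using R(5)[OF assms(2)] by (simp add: cyclotomic_eq_recip)
  then have "g x * exp (- (tau / 2 * f_fun n x)) * (delta t * poly (recip_prod (- 1)) x)
     = (delta t * delta t) * poly (recip_prod 1) x * poly (recip_prod (- 1)) x"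
    unfolding 1[symmetric] d(1) mult_inverse_pair[OF inv] by simp
  then have "(g x * exp (- (tau / 2 * f_fun n x))) * (delta t * poly (recip_prod (- 1)) x)
     = (delta t * poly (recip_prod 1) x) * (delta t * poly (recip_prod (- 1)) x)"
    by (simp add: mult_ac)
  then show "g x * exp (- (tau / 2 * f_fun n x)) = delta t * poly (recip_prod 1) x"
    using nz[OF assms(2)] d(2) by simp
qed

text \<open>The explicit cases collect three signs: \<open>eps\<close> from replacing root products
  by reciprocal products, s from the exchange of the classes, which only B notices, and
  \<open>delta t\<close> from the choice of the square root.\<close>

lemma sign_eq: "sign_A n t = eps * delta t" "sign_B n t = of_int (gauss_s n) * eps * delta t"
  using gauss_s_cases by (auto simp: sign_A_def sign_B_def delta_def eps_cases)

lemma branch_formulas: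
  assumes "sqrt_branch n R t g" "x \<in> R"
  shows "poly (map_poly of_int A) x = sign_A n t * (2 * g x * cosh (tau / 2 * f_fun n x))"
    and "poly (map_poly of_int B) x = sign_B n t * (2 * (g x / tau) * sinh (tau / 2 * f_fun n x))"
proof -
  note e = branch_exp[OF assms]
  have d: "delta t * delta t = 1" by (auto simp: delta_def eps_cases)
  have "2 * g x * cosh (tau / 2 * f_fun n x) = g x * exp (tau / 2 * f_fun n x) + g x * exp (- (tau / 2 * f_fun n x))"
    by (simp add: cosh_field_def field_simps)
  then have c: "2 * g x * cosh (tau / 2 * f_fun n x) = delta t * poly (recip_prod (- 1)) x + delta t * poly (recip_prod 1) x"
    unfolding e .
  have "sign_A n t * (2 * g x * cosh (tau / 2 * f_fun n x)) = (delta t * delta t) * (eps * (poly (recip_prod 1) x + poly (recip_prod (- 1)) x))"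
    unfolding sign_eq c by (simp add: algebra_simps)
  also have "\<dots> = poly (map_poly of_int A) x"
    unfolding gauss_pair_recip(1) d by simp
  finally show "poly (map_poly of_int A) x = sign_A n t * (2 * g x * cosh (tau / 2 * f_fun n x))" ..
  have "2 * g x * sinh (tau / 2 * f_fun n x) = g x * exp (tau / 2 * f_fun n x) - g x * exp (- (tau / 2 * f_fun n x))"
    by (simp add: sinh_field_def field_simps)
  then have s: "2 * g x * sinh (tau / 2 * f_fun n x) = delta t * poly (recip_prod (- 1)) x - delta t * poly (recip_prod 1) x"
    unfolding e .
  have "sign_B n t * (2 * g x * sinh (tau / 2 * f_fun n x)) = (delta t * delta t) * (of_int (gauss_s n) * eps * (poly (recip_prod (- 1)) x - poly (recip_prod 1) x))"
    unfolding sign_eq s by (simp add: algebra_simps)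
  also have "\<dots> = poly (Polynomial.smult tau (map_poly of_int B)) x"
    unfolding gauss_pair_recip(2) d by simp
  finally show "poly (map_poly of_int B) x = sign_B n t * (2 * (g x / tau) * sinh (tau / 2 * f_fun n x))"
    using tau_nz by (simp add: field_simps)
qed

section \<open>The identities for formal power series\<close>

definition fps_exp_f :: "complex \<Rightarrow> complex fps" where "fps_exp_f c = fps_exp c oo f_fps n"

lemma f_fps_0: "fps_nth (f_fps n) 0 = 0" by (simp add: f_fps_def)

lemma fps_exp_f_mult: "fps_exp_f c * fps_exp_f d = fps_exp_f (c + d)"
  unfolding fps_exp_f_def fps_exp_add_mult
  by (rule fps_compose_mult_distrib[symmetric]) (rule f_fps_0)

text \<open>The analytic identity near 0 is transferred by uniqueness of power series
  expansions.\<close>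

lemma fps_exp_f_tau: "fps_exp_f tau * fps_of_poly (recip_prod 1) = fps_of_poly (recip_prod (- 1))"
proof -
  have "((\<lambda>x. exp (tau * x)) \<circ> f_series n) has_fps_expansion fps_exp_f tau"
    unfolding fps_exp_f_def
    by (intro has_fps_expansion_compose has_fps_expansion_exp f_series_has_fps_expansion f_fps_0)
  then have "(\<lambda>x. exp (tau * f_series n x) * poly (recip_prod 1) x) has_fps_expansion
      fps_exp_f tau * fps_of_poly (recip_prod 1)"
    by (intro has_fps_expansion_mult poly_has_fps_expansion) (simp add: o_def)
  moreover have ev: "\<forall>\<^sub>F x in nhds 0. exp (tau * f_series n x) * poly (recip_prod 1) x = poly (recip_prod (- 1)) x"
    using eventually_nhds_in_open[of "ball 0 1" "0 :: complex"]
  proof (rule eventually_mono)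
    fix x :: complex assume "x \<in> ball 0 1"
    then show "exp (tau * f_series n x) * poly (recip_prod 1) x = poly (recip_prod (- 1)) x"
      using recip_prod_nonzero[of x] by (intro exp_tau_f_series) auto
  qed auto
  ultimately have "poly (recip_prod (- 1)) has_fps_expansion fps_exp_f tau * fps_of_poly (recip_prod 1)"
    using has_fps_expansion_cong[OF ev refl] by blast
  then show ?thesis using poly_has_fps_expansion fps_expansion_unique_complex by blast
qed

lemma cyclotomic_sqrt_fps_square: "cyclotomic_sqrt_fps n * cyclotomic_sqrt_fps n = fps_of_poly (cyclotomic n)"
  and cyclotomic_sqrt_fps_0: "fps_nth (cyclotomic_sqrt_fps n) 0 = 1"
proof -
  have c: "fps_nth (fps_of_poly (cyclotomic n)) 0 = 1"
    by (simp add: cyclotomic_eq_recip flip: poly_0_coeff_0)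
  then show "fps_nth (cyclotomic_sqrt_fps n) 0 = 1" by (simp add: cyclotomic_sqrt_fps_def)
  have "(fps_radical (\<lambda>_. csqrt) (Suc 1) (fps_of_poly (cyclotomic n))) ^ Suc 1 = fps_of_poly (cyclotomic n)"
    by (subst power_radical[symmetric]) (use c in auto)
  then show "cyclotomic_sqrt_fps n * cyclotomic_sqrt_fps n = fps_of_poly (cyclotomic n)"
    by (simp add: cyclotomic_sqrt_fps_def numeral_2_eq_2)
qed

lemma cyclotomic_sqrt_fps_exp:
  shows "cyclotomic_sqrt_fps n * fps_exp_f (tau / 2) = fps_of_poly (recip_prod (- 1))"
    and "cyclotomic_sqrt_fps n * fps_exp_f (- (tau / 2)) = fps_of_poly (recip_prod 1)"
proof -
  let ?S = "cyclotomic_sqrt_fps n" and ?E = "fps_exp_f (tau / 2)"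
  let ?P = "fps_of_poly (recip_prod 1)" and ?M = "fps_of_poly (recip_prod (- 1))"
  have E: "?E * ?E = fps_exp_f tau" by (simp add: fps_exp_f_mult)
  have E0: "fps_exp_f 0 = 1" by (simp add: fps_exp_f_def)
  have S: "?S * ?S = ?P * ?M"
    by (simp add: cyclotomic_sqrt_fps_square cyclotomic_eq_recip fps_of_poly_mult)
  \<comment> \<open>Power series have no zero divisors, and the second factor has constant term 2,
    so the first vanishes. This is the formal counterpart of fixing the sign at 0.\<close>
  have "(?S * ?E - ?M) * (?S * ?E + ?M) = (?S * ?S) * (?E * ?E) - ?M * ?M"
    by (simp add: algebra_simps)
  also have "\<dots> = 0" unfolding E S fps_exp_f_tau[symmetric] by (simp add: mult_ac)
  finally have "(?S * ?E - ?M) * (?S * ?E + ?M) = 0" .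
  moreover have "fps_nth (?S * ?E + ?M) 0 = 2"
    by (simp add: cyclotomic_sqrt_fps_0 fps_exp_f_def flip: poly_0_coeff_0)
  then have "?S * ?E + ?M \<noteq> 0" by (metis fps_zero_nth zero_neq_numeral)
  ultimately show 1: "?S * ?E = ?M" by simp
  have "?S * fps_exp_f (- (tau / 2)) * ?M = (?S * ?S) * (fps_exp_f (- (tau / 2)) * ?E)"
    unfolding 1[symmetric] by (simp add: mult_ac)
  also have "\<dots> = ?P * ?M" unfolding fps_exp_f_mult S by (simp add: E0)
  finally have "?S * fps_exp_f (- (tau / 2)) * ?M = ?P * ?M" .
  moreover have "fps_nth ?M 0 = 1" by (simp flip: poly_0_coeff_0)
  then have "?M \<noteq> 0" by (metis fps_zero_nth zero_neq_one)
  ultimately show "?S * fps_exp_f (- (tau / 2)) = ?P" by simp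
qed

lemma fps_formulas:
  shows "fps_of_poly (map_poly of_int A) =
      fps_const (sign_A n 0 * 2) * cyclotomic_sqrt_fps n * (fps_cosh (tau / 2) oo f_fps n)"
    and "fps_of_poly (map_poly of_int B) =
      fps_const (sign_B n 0 * 2 / tau) * cyclotomic_sqrt_fps n * (fps_sinh (tau / 2) oo f_fps n)"
proof -
  let ?S = "cyclotomic_sqrt_fps n"
  have c: "fps_cosh (tau / 2) oo f_fps n = fps_const (1 / 2) * (fps_exp_f (tau / 2) + fps_exp_f (- (tau / 2)))"
    unfolding fps_cosh_def fps_exp_f_def
    by (simp only: fps_compose_mult_distrib[OF f_fps_0] fps_compose_add_distrib fps_const_compose)
  have s: "fps_sinh (tau / 2) oo f_fps n = fps_const (1 / 2) * (fps_exp_f (tau / 2) - fps_exp_f (- (tau / 2)))"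
    unfolding fps_sinh_def fps_exp_f_def
    by (simp only: fps_compose_mult_distrib[OF f_fps_0] fps_compose_sub_distrib fps_const_compose)
  \<comment> \<open>The square root with constant term 1 corresponds to the branch that is positive
    at t = 0.\<close>
  have d: "delta 0 = 1" by (simp add: delta_def)
  have "fps_const (sign_A n 0 * 2) * ?S * (fps_cosh (tau / 2) oo f_fps n) =
      fps_const (sign_A n 0 * 2) * fps_const (1 / 2) * (?S * fps_exp_f (tau / 2) + ?S * fps_exp_f (- (tau / 2)))"
    unfolding c by (simp only: distrib_left mult_ac)
  also have "\<dots> = fps_const eps * (fps_of_poly (recip_prod (- 1)) + fps_of_poly (recip_prod 1))"
    unfolding cyclotomic_sqrt_fps_exp sign_eq d by simp
  also have "\<dots> = fps_of_poly (map_poly of_int A)"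
    unfolding gauss_pair_recip(1) by (simp add: fps_of_poly_smult fps_of_poly_add add.commute)
  finally show "fps_of_poly (map_poly of_int A) =
      fps_const (sign_A n 0 * 2) * ?S * (fps_cosh (tau / 2) oo f_fps n)" ..
  have B: "map_poly of_int B = Polynomial.smult (of_int (gauss_s n) * eps / tau) (recip_prod (- 1) - recip_prod 1)"
  proof (rule smult_left_cancel[OF _ tau_nz])
    show "Polynomial.smult tau (map_poly of_int B) =
      Polynomial.smult tau (Polynomial.smult (of_int (gauss_s n) * eps / tau) (recip_prod (- 1) - recip_prod 1))"
      unfolding gauss_pair_recip(2) using tau_nz by simp
  qed
  have "fps_const (sign_B n 0 * 2 / tau) * ?S * (fps_sinh (tau / 2) oo f_fps n) =
      fps_const (sign_B n 0 * 2 / tau) * fps_const (1 / 2) * (?S * fps_exp_f (tau / 2) - ?S * fps_exp_f (- (tau / 2)))"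
    unfolding s by (simp only: right_diff_distrib mult_ac)
  also have "\<dots> = fps_const (of_int (gauss_s n) * eps / tau) * (fps_of_poly (recip_prod (- 1)) - fps_of_poly (recip_prod 1))"
    unfolding cyclotomic_sqrt_fps_exp sign_eq d by simp
  also have "\<dots> = fps_of_poly (map_poly of_int B)"
    unfolding B by (simp add: fps_of_poly_smult fps_of_poly_diff)
  finally show "fps_of_poly (map_poly of_int B) =
      fps_const (sign_B n 0 * 2 / tau) * ?S * (fps_sinh (tau / 2) oo f_fps n)" ..
qed

end

lemma sqrt_sn_cases: "sqrt_sn n = tau \<or> sqrt_sn n = - tau"
proof -
  have "(sqrt_sn n)\<^sup>2 = tau\<^sup>2" unfolding tau_square sqrt_sn_def by simp
  then show ?thesis by (simp only: power2_eq_iff)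
qed

lemma fps_cosh_minus: "fps_cosh (- c) = fps_cosh c" by (simp add: fps_cosh_def add.commute)

lemma fps_sinh_minus: "fps_sinh (- c) = - fps_sinh c" by (simp add: fps_sinh_def algebra_simps)

end

theorem theorem1:
  fixes n :: nat and A B :: "int poly"
  assumes "odd n" and "squarefree n" and "n > 3"
    and "gauss_pair n A B"
  shows
    "(fps_of_poly (map_poly of_int A) =
        fps_const (sign_A n 0 * 2) * cyclotomic_sqrt_fps n * (fps_cosh (sqrt_sn n / 2) oo f_fps n) \<and>
      fps_of_poly (map_poly of_int B) =
        fps_const (sign_B n 0 * 2 / sqrt_sn n) * cyclotomic_sqrt_fps n *
          (fps_sinh (sqrt_sn n / 2) oo f_fps n)) \<and>
     (\<forall>R t g. sqrt_branch n R t g \<longrightarrow>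
       (\<forall>x\<in>R.
          poly (map_poly of_int A) x =
            sign_A n t * (2 * g x * cosh (sqrt_sn n / 2 * f_fun n x)) \<and>
          poly (map_poly of_int B) x =
            sign_B n t * (2 * (g x / sqrt_sn n) * sinh (sqrt_sn n / 2 * f_fun n x))))"
proof -
  interpret odd_squarefree n by unfold_locales (use assms in auto)
  note F = fps_formulas[OF assms(4)] and G = branch_formulas[OF assms(4)]
  show ?thesis
    using sqrt_sn_cases
  proof
    assume "sqrt_sn n = tau"
    then show ?thesis using F G by simp
  next
    assume r: "sqrt_sn n = - tau"
    \<comment> \<open>Both the divisor and the argument of the hyperbolic sine change sign, and the
      two signs cancel.\<close>
    have "fps_const (sign_B n 0 * 2 / sqrt_sn n) = - fps_const (sign_B n 0 * 2 / tau)"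
      "sqrt_sn n / 2 = - (tau / 2)"
      by (simp_all add: r)
    then have "fps_const (sign_B n 0 * 2 / sqrt_sn n) * cyclotomic_sqrt_fps n * (fps_sinh (sqrt_sn n / 2) oo f_fps n) =
        fps_const (sign_B n 0 * 2 / tau) * cyclotomic_sqrt_fps n * (fps_sinh (tau / 2) oo f_fps n)"
      by (simp only: fps_sinh_minus fps_compose_uminus mult_minus_left mult_minus_right minus_minus)
    moreover have "fps_cosh (sqrt_sn n / 2) = fps_cosh (tau / 2)"
      using fps_cosh_minus[of "tau / 2"] r by simp
    ultimately show ?thesis
      using F G by (simp only: r) (simp add: cosh_minus)
  qed
qed

end
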